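(* Let $n_1,n_2,n_3,n_4\in\mathbb{N}_0$ with $n_1\ge 1$ or $n_3\ge 1$. Let $\lambda>0$ and let real numbers be given such that $$b_j\ge 0\ (1\le j\le n_1);\quad c_j\ge 0,\ d_j\ge c_j+1\ (1\le j\le n_2);\quad r_j>0,\ o_j\ge 0\ (1\le j\le n_3);\quad v_j>0,\ w_j\ge v_j+1\ (1\le j\le n_4).$$ Set $m'=n_1+n_2+n_3$, $n'=n_3+n_4$, $p'=n_2+n_3+n_4$, $q'=n_1+n_2+n_3+n_4$, and define the ordered lists $$(\alpha'_j)_1^{p'}=(1-r_j)_1^{n_3},\,(1-v_j)_1^{n_4},\,(d_j)_1^{n_2},$$ $$(\beta'_j)_1^{q'}=(b_j)_1^{n_1},\,(c_j)_1^{n_2},\,(o_j)_1^{n_3},\,(1-w_j)_1^{n_4},$$ and $A'_1=\dots=A'_{p'}=B'_1=\dots=B'_{q'}=\lambda$. Assume $A'_j(\beta'_{j'}+l)\ne B'_{j'}(\alpha'_j-l'-1)$ for all $j=1,\dots,n'$, $j'=1,\dots,m'$, $l,l'\in\mathbb{N}_0$. Then $$G^{m',n'}_{p',q'}\left[t\,\Big|\begin{array}{c}\alpha'_1\pm\omega,\dots,\alpha'_{p'}\pm\omega\\ \beta'_1\pm\omega,\dots,\beta'_{q'}\pm\omega\end{array}\right]>0\qquad\text{for every }\omega>0\text{ and }t>0,$$ for either choice of the sign $\pm$ (the same for all parameters).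
   Context: $\mathbb{N}_0=\{0,1,2,\dots\}$. The notation $(x_j)_1^l$ stands for the list $x_1,\dots,x_l$ and $(x_j,X_j)_1^l$ for $(x_1,X_1),\dots,(x_l,X_l)$ (empty lists if $l=0$); lists separated by commas are concatenated. Meijer $G$-function: for every $\lambda>0$, $$G^{m,n}_{p,q}\left[z^{1/\lambda}\,\Big|\begin{array}{c}\alpha_1,\dots,\alpha_p\\\beta_1,\dots,\beta_q\end{array}\right]=\lambda\,H^{m,n}_{p,q}\left[z\,\Big|\begin{array}{c}(\alpha_j,\lambda)_1^p\\(\beta_j,\lambda)_1^q\end{array}\right]$$ (the left side does not depend on $\lambda$ as a function of $z^{1/\lambda}$; $\lambda=1$ gives the usual definition). Fox $H$-function. For $0\le n\le p$, $0\le m\le q$, $A_j,B_j>0$, $\alpha_j,\beta_j\in\mathbb{C}$ with $A_j(l+\beta_{j'})\ne B_{j'}(\alpha_j-l'-1)$ for all $1\le j\le n$, $1\le j'\le m$, $l,l'\in\mathbb{N}_0$, put $$\Xi^{m,n}_{p,q}(s)=\frac{\prod_{j=1}^m\Gamma(\beta_j+B_js)\prod_{j=1}^n\Gamma(1-\alpha_j-A_js)}{\prod_{j=m+1}^q\Gamma(1-\beta_j-B_js)\prod_{j=n+1}^p\Gamma(\alpha_j+A_js)}$$ (empty products are $1$), and $$H^{m,n}_{p,q}\left[z\,\Big|\begin{array}{c}(\alpha_j,A_j)_1^p\\(\beta_j,B_j)_1^q\end{array}\right]=\frac{1}{2\pi i}\int_{\mathcal C}\Xi^{m,n}_{p,q}(s)\,z^{-s}\,ds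 .$$ Let $\chi=\sum_{j=1}^nA_j-\sum_{j=n+1}^pA_j+\sum_{j=1}^mB_j-\sum_{j=m+1}^qB_j$. When $\chi>0$ (as is the case here) and $z>0$, $\mathcal C$ is a contour going from $\gamma-i\infty$ to $\gamma+i\infty$ ($\gamma\in\mathbb{R}$), leaving all poles of $\Gamma(\beta_j+B_js)$, $1\le j\le m$, on its left and all poles of $\Gamma(1-\alpha_j-A_js)$, $1\le j\le n$, on its right; the integral converges and does not depend on the choice of such a contour. *)

theory Defs
  imports "HOL-Complex_Analysis.Complex_Analysis"
begin

text \<open>A simple, locally piecewise continuously differentiable curve running from
  \<open>\<gamma> - i\<infinity>\<close> to \<open>\<gamma> + i\<infinity>\<close>.\<close>

definition vertical_contour :: "real \<Rightarrow> (real \<Rightarrow> complex) \<Rightarrow> bool" where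
  "vertical_contour \<gamma> g \<longleftrightarrow>
     inj g \<and>
     (\<forall>a b. a < b \<longrightarrow> g piecewise_C1_differentiable_on {a..b}) \<and>
     ((\<lambda>t. Re (g t)) \<longlongrightarrow> \<gamma>) at_bot \<and> filterlim (\<lambda>t. Im (g t)) at_bot at_bot \<and>
     ((\<lambda>t. Re (g t)) \<longlongrightarrow> \<gamma>) at_top \<and> filterlim (\<lambda>t. Im (g t)) at_top at_top"

text \<open>Such a curve has real part bounded on both sides and cuts the plane into two components.
  The component to its left is the one that contains every point lying
  horizontally to the left of the whole curve; similarly on the right.\<close>

definition left_of_contour :: "(real \<Rightarrow> complex) \<Rightarrow> complex set" where
  "left_of_contour g =
     {p. \<exists>x. (\<forall>t. Re x < Re (g t)) \<and> connected_component (- range g) p x}"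

definition right_of_contour :: "(real \<Rightarrow> complex) \<Rightarrow> complex set" where
  "right_of_contour g =
     {p. \<exists>x. (\<forall>t. Re (g t) < Re x) \<and> connected_component (- range g) p x}"

text \<open>The integral along the whole curve is improper: both ends tend to infinity
  independently.\<close>

definition has_improper_contour_integral ::
    "(complex \<Rightarrow> complex) \<Rightarrow> complex \<Rightarrow> (real \<Rightarrow> complex) \<Rightarrow> bool" where
  "has_improper_contour_integral f I g \<longleftrightarrow>
     ((\<lambda>(a, b). integral {a..b} (\<lambda>t. f (g t) * vector_derivative g (at t))) \<longlongrightarrow> I)
       (at_bot \<times>\<^sub>F at_top)"

text \<open>The parameter lists \<open>as\<close> and \<open>bs\<close> consist of the pairs \<open>(\<alpha>\<^sub>j, A\<^sub>j)\<close> and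
  \<open>(\<beta>\<^sub>j, B\<^sub>j)\<close>; thus \<open>p\<close> and \<open>q\<close> are their lengths. The Gamma functions in
  the denominator are expressed by the entire function \<open>rGamma = 1 / Gamma\<close>.\<close>

definition fox_Xi ::
    "nat \<Rightarrow> nat \<Rightarrow> (complex \<times> real) list \<Rightarrow> (complex \<times> real) list \<Rightarrow> complex \<Rightarrow> complex" where
  "fox_Xi m n as bs s =
     (\<Prod>(\<beta>, B)\<leftarrow>take m bs. Gamma (\<beta> + of_real B * s)) *
     (\<Prod>(\<alpha>, A)\<leftarrow>take n as. Gamma (1 - \<alpha> - of_real A * s)) *
     (\<Prod>(\<beta>, B)\<leftarrow>drop m bs. rGamma (1 - \<beta> - of_real B * s)) *
     (\<Prod>(\<alpha>, A)\<leftarrow>drop n as. rGamma (\<alpha> + of_real A * s))"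

definition fox_contour ::
    "nat \<Rightarrow> nat \<Rightarrow> (complex \<times> real) list \<Rightarrow> (complex \<times> real) list \<Rightarrow> (real \<Rightarrow> complex) \<Rightarrow> bool" where
  "fox_contour m n as bs g \<longleftrightarrow>
     (\<exists>\<gamma>. vertical_contour \<gamma> g) \<and>
     (\<forall>(\<beta>, B)\<in>set (take m bs). \<forall>p.
        is_pole (\<lambda>s. Gamma (\<beta> + of_real B * s)) p \<longrightarrow> p \<in> left_of_contour g) \<and>
     (\<forall>(\<alpha>, A)\<in>set (take n as). \<forall>p.
        is_pole (\<lambda>s. Gamma (1 - \<alpha> - of_real A * s)) p \<longrightarrow> p \<in> right_of_contour g)"

text \<open>The \<open>H\<close>-function for positive real argument in the case \<open>\<chi> > 0\<close>, where \<open>\<chi>\<close> is the sum of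
  the \<open>A\<^sub>j\<close> with \<open>j \<le> n\<close> and the \<open>B\<^sub>j\<close> with \<open>j \<le> m\<close> minus the sum of the remaining
  ones. The integral then converges along every contour as above and its value does not
  depend on the contour; that common value is the one denoted by \<open>THE\<close>. Other contours
  would be needed for \<open>\<chi> \<le> 0\<close>.\<close>

definition fox_H ::
    "nat \<Rightarrow> nat \<Rightarrow> (complex \<times> real) list \<Rightarrow> (complex \<times> real) list \<Rightarrow> real \<Rightarrow> complex" where
  "fox_H m n as bs z =
     1 / (2 * of_real pi * \<i>) *
     (THE I. \<exists>g. fox_contour m n as bs g \<and>
        has_improper_contour_integral
          (\<lambda>s. fox_Xi m n as bs s * complex_of_real z powr (- s)) I g)"

text \<open>The substitution \<open>s \<mapsto> s / \<lambda>\<close> shows that taking all \<open>A\<^sub>j = B\<^sub>j = \<lambda> > 0\<close>, argument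
  \<open>z powr \<lambda>\<close> and a factor \<open>\<lambda>\<close> in front would give the same function of \<open>z\<close>.\<close>

definition meijer_G ::
    "nat \<Rightarrow> nat \<Rightarrow> complex list \<Rightarrow> complex list \<Rightarrow> real \<Rightarrow> complex" where
  "meijer_G m n as bs z = fox_H m n (map (\<lambda>\<alpha>. (\<alpha>, 1)) as) (map (\<lambda>\<beta>. (\<beta>, 1)) bs) z"

end

theory Submission
  imports Defs "HOL-Probability.Characteristic_Functions" "HOL-Probability.Sinc_Integral"
begin

text \<open>
  In the variable \<open>s \<plusminus> \<omega>\<close> the poles to be left of the contour have real part at most \<open>0\<close> and
  those to be right of it have positive real part, so a vertical line separates them. On that line
  every factor \<open>\<Gamma>(b + s)\<close>, \<open>\<Gamma>(r - s)\<close>, \<open>\<Gamma>(c + s) / \<Gamma>(d + s)\<close>, \<open>\<Gamma>(v - s) / \<Gamma>(w - s)\<close> is, up to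
  normalisation, the characteristic function of a finite positive measure (Gamma and Beta
  integrals). Multiplying an integrand by such a factor convolves its inverse transform with the
  measure, which preserves strict positivity by Fubini. It remains to treat a single factor
  \<open>\<Gamma>(b + s)\<close>, present because \<open>n\<^sub>1 \<ge> 1\<close> or \<open>n\<^sub>3 \<ge> 1\<close>; there a Gaussian regularisation bounds the inverse
  transform away from \<open>0\<close>.

  An arbitrary admissible contour gives the same integral as the line by the homology form of
  Cauchy's theorem: truncate it, close it up through the line, and check that the winding
  number about each pole vanishes.
\<close>

subsection \<open>Positive inverse transforms\<close>

text \<open>\<open>fox_H\<close> is a definite description ranging over all admissible contours, so
  evaluating one convenient line does not suffice: the value is pinned down only when every such
  contour is shown to give the same limit. All decay is drawn from a single factor
  \<open>Gamma (b + s)\<close>. The quotients of Gamma functions decay only like a power of the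
  height, in general too slowly for absolute convergence, so the remaining factors are merely asked
  to be mixtures on the line and bounded on strips. The one good factor makes the line integral
  absolutely convergent and the horizontal closing segments negligible. The bounds avoid Stirling's
  formula: the functional equation shifts the argument far enough to the right, where the function
  is a characteristic function along each vertical line and is dominated by its value at the real
  point. On the line with real part \<open>R\<close>, \<open>t powr (- s)\<close> is a positive
  constant times a character evaluated at \<open>ln t\<close>; hence positivity of an inverse
  Fourier transform at every point is the notion to propagate.\<close>

definition positive_transform :: "(real \<Rightarrow> complex) \<Rightarrow> bool" where
  "positive_transform \<Phi> \<longleftrightarrow> integrable lborel \<Phi> \<and>
     (\<forall>\<tau>. \<exists>p>0. (LINT y|lborel. \<Phi> y * cis (- (\<tau> * y))) = complex_of_real p)"

text \<open>\<open>K\<close> is the characteristic function of the image under \<open>\<theta>\<close> of the nonzero finite measure with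
  density \<open>k\<close>; keeping \<open>\<theta>\<close> (which is \<open>ln\<close> or \<open>- ln\<close> below) avoids substitutions in Mellin
  integrals.\<close>

definition positive_mixture :: "(real \<Rightarrow> complex) \<Rightarrow> bool" where
  "positive_mixture K \<longleftrightarrow> (\<exists>k \<theta> :: real \<Rightarrow> real. (\<forall>x. k x \<ge> 0) \<and> integrable lborel k \<and> integral\<^sup>L lborel k > 0 \<and>
     \<theta> \<in> borel_measurable borel \<and>
     (\<forall>y. K y = (LINT x|lborel. complex_of_real (k x) * cis (y * \<theta> x))))"

lemma cis_measurable [measurable]: "cis \<in> borel_measurable borel"
  by (intro borel_measurable_continuous_onI continuous_intros)

lemma positive_mixture_uminus:
  assumes "positive_mixture K"
  shows "positive_mixture (\<lambda>y. K (- y))"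
proof -
  obtain k \<theta> :: "real \<Rightarrow> real" where *: "\<And>x. k x \<ge> 0" "integrable lborel k" "integral\<^sup>L lborel k > 0"
      "\<theta> \<in> borel_measurable borel"
      "\<And>y. K y = (LINT x|lborel. complex_of_real (k x) * cis (y * \<theta> x))"
    using assms unfolding positive_mixture_def by auto
  show ?thesis unfolding positive_mixture_def
    by (rule exI[of _ k], rule exI[of _ "\<lambda>x. - \<theta> x"]) (use * in auto)
qed

lemma norm_mixture_le:
  assumes "\<And>x. k x \<ge> 0" "integrable lborel k"
  shows "norm (LINT x|lborel. complex_of_real (k x) * cis (y * \<theta> x)) \<le> integral\<^sup>L lborel k"
proof -
  have "norm (LINT x|lborel. complex_of_real (k x) * cis (y * \<theta> x))
      \<le> (LINT x|lborel. norm (complex_of_real (k x) * cis (y * \<theta> x)))"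
    by (rule integral_norm_bound)
  also have "\<dots> = integral\<^sup>L lborel k"
    using assms(1) by (simp add: norm_mult)
  finally show ?thesis .
qed

text \<open>The value at 0 is the total mass, which dominates all other values. This takes the place
  of asymptotics: bounds on a vertical line reduce to bounds at its real point.\<close>

lemma norm_positive_mixture_le:
  assumes "positive_mixture K"
  shows "norm (K y) \<le> norm (K 0)"
proof -
  obtain k \<theta> :: "real \<Rightarrow> real" where *: "\<And>x. k x \<ge> 0" "integrable lborel k" "integral\<^sup>L lborel k > 0"
      "\<And>y. K y = (LINT x|lborel. complex_of_real (k x) * cis (y * \<theta> x))"
    using assms unfolding positive_mixture_def by auto
  have "K 0 = complex_of_real (integral\<^sup>L lborel k)"
    by (simp add: *(4))
  then have "norm (K 0) = integral\<^sup>L lborel k" using *(3) by simp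
  then show ?thesis using norm_mixture_le[OF *(1,2)] *(4) by simp
qed

lemma positive_transform_mult:
  assumes \<Phi>: "positive_transform \<Phi>" and K: "positive_mixture K"
  shows "positive_transform (\<lambda>y. \<Phi> y * K y)"
proof -
  obtain k \<theta> :: "real \<Rightarrow> real" where k0: "\<And>x. k x \<ge> 0" and ki: "integrable lborel k"
      and kpos: "integral\<^sup>L lborel k > 0"
      and \<theta>[measurable]: "\<theta> \<in> borel_measurable borel"
      and Keq: "\<And>y. K y = (LINT x|lborel. complex_of_real (k x) * cis (y * \<theta> x))"
    using K unfolding positive_mixture_def by auto
  have \<Phi>i: "integrable lborel \<Phi>" using \<Phi> by (simp add: positive_transform_def)
  have [measurable]: "\<Phi> \<in> borel_measurable borel" "k \<in> borel_measurable borel"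
    using \<Phi>i ki by auto
  have Kmeas[measurable]: "K \<in> borel_measurable borel"
    unfolding Keq by measurable
  have int: "integrable lborel (\<lambda>y. \<Phi> y * K y)"
  proof (rule Bochner_Integration.integrable_bound)
    show "integrable lborel (\<lambda>y. \<Phi> y * complex_of_real (integral\<^sup>L lborel k))"
      using \<Phi>i by simp
    have "norm (K y) \<le> integral\<^sup>L lborel k" for y
      unfolding Keq by (rule norm_mixture_le[OF k0 ki])
    then show "AE y in lborel. norm (\<Phi> y * K y) \<le> norm (\<Phi> y * complex_of_real (integral\<^sup>L lborel k))"
      using kpos by (intro AE_I2) (auto simp: norm_mult intro!: mult_left_mono)
  qed auto
  obtain \<phi> where \<phi>: "\<And>\<tau>. \<phi> \<tau> > 0"
      "\<And>\<tau>. (LINT y|lborel. \<Phi> y * cis (- (\<tau> * y))) = complex_of_real (\<phi> \<tau>)"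
    using \<Phi> unfolding positive_transform_def by metis
  have "\<exists>p>0. (LINT y|lborel. (\<Phi> y * K y) * cis (- (\<tau> * y))) = complex_of_real p" for \<tau>
  proof -
    \<comment> \<open>The two phases combine into a translate, so integrating \<open>f\<close> over
      \<open>y\<close> first yields \<open>\<phi>\<close> at \<open>\<tau> - \<theta> x\<close> with
      weight \<open>k x\<close>.\<close>
    define f where "f = (\<lambda>(x, y). complex_of_real (k x) * (\<Phi> y * cis (- ((\<tau> - \<theta> x) * y))))"
    have fint: "integrable (lborel \<Otimes>\<^sub>M lborel) f"
    proof (rule lborel_pair.Fubini_integrable)
      show "f \<in> borel_measurable (lborel \<Otimes>\<^sub>M lborel)" unfolding f_def by measurable
      have "(\<lambda>x. LINT y|lborel. norm (f (x, y))) = (\<lambda>x. k x * (LINT y|lborel. norm (\<Phi> y)))"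
        using k0 by (simp add: f_def norm_mult)
      then show "integrable lborel (\<lambda>x. LINT y|lborel. norm (f (x, y)))"
        using ki by simp
      show "AE x in lborel. integrable lborel (\<lambda>y. f (x, y))"
        unfolding f_def
        by (intro AE_I2) (auto intro!: integrable_mult_right Bochner_Integration.integrable_bound[OF \<Phi>i]
            AE_I2 simp: norm_mult)
    qed
    have inner: "(LINT y|lborel. f (x, y)) = complex_of_real (k x * \<phi> (\<tau> - \<theta> x))" for x
      using \<phi>(2)[of "\<tau> - \<theta> x"] by (simp add: f_def)
    have i1: "integrable lborel (\<lambda>x. complex_of_real (k x * \<phi> (\<tau> - \<theta> x)))"
      using lborel_pair.integrable_fst'[OF fint] inner by simp
    then have i2: "integrable lborel (\<lambda>x. k x * \<phi> (\<tau> - \<theta> x))"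
      by (simp only: complex_of_real_integrable_eq)
    have "(LINT y|lborel. (\<Phi> y * K y) * cis (- (\<tau> * y)))
        = (LINT y|lborel. LINT x|lborel. f (x, y))"
    proof (rule Bochner_Integration.integral_cong[OF refl])
      fix y
      have "(\<Phi> y * K y) * cis (- (\<tau> * y)) =
          (LINT x|lborel. (\<Phi> y * cis (- (\<tau> * y))) * (complex_of_real (k x) * cis (y * \<theta> x)))"
        by (subst integral_mult_right_zero) (simp add: Keq mult_ac)
      also have "\<dots> = (LINT x|lborel. f (x, y))"
        by (rule Bochner_Integration.integral_cong[OF refl])
           (simp add: f_def cis_mult algebra_simps)
      finally show "(\<Phi> y * K y) * cis (- (\<tau> * y)) = (LINT x|lborel. f (x, y))" .
    qed
    also have "\<dots> = (LINT x|lborel. LINT y|lborel. f (x, y))"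
      using lborel_pair.Fubini_integral[of "\<lambda>x y. f (x, y)"] fint by simp
    also have "\<dots> = complex_of_real (LINT x|lborel. k x * \<phi> (\<tau> - \<theta> x))"
      by (simp add: inner del: of_real_mult)
    finally have eq: "(LINT y|lborel. (\<Phi> y * K y) * cis (- (\<tau> * y))) = \<dots>" .
    have nonneg: "0 \<le> k x * \<phi> (\<tau> - \<theta> x)" for x using k0 \<phi>(1) by (simp add: less_imp_le)
    \<comment> \<open>Since \<open>\<phi>\<close> vanishes nowhere, a zero integral would force
      \<open>k\<close> to vanish almost everywhere, against its positive mass.\<close>
    have "(LINT x|lborel. k x * \<phi> (\<tau> - \<theta> x)) \<noteq> 0"
    proof
      assume "(LINT x|lborel. k x * \<phi> (\<tau> - \<theta> x)) = 0"
      then have "AE x in lborel. k x * \<phi> (\<tau> - \<theta> x) = 0"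
        using integral_nonneg_eq_0_iff_AE[OF i2] nonneg by simp
      then have "AE x in lborel. k x = 0"
        by (rule AE_mp) (use \<phi>(1) in \<open>auto intro!: AE_I2 simp: less_imp_neq[symmetric]\<close>)
      then have "integral\<^sup>L lborel k = 0"
        by (rule integral_eq_zero_AE)
      with kpos show False by simp
    qed
    moreover have "(LINT x|lborel. k x * \<phi> (\<tau> - \<theta> x)) \<ge> 0"
      using nonneg by (intro Bochner_Integration.integral_nonneg) auto
    ultimately show ?thesis using eq by (intro exI[of _ "LINT x|lborel. k x * \<phi> (\<tau> - \<theta> x)"]) auto
  qed
  then show ?thesis using int unfolding positive_transform_def by blast
qed

lemma positive_mixture_mult_list:
  assumes "positive_transform \<Phi>" "\<And>K. K \<in> set Ks \<Longrightarrow> positive_mixture K"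
  shows "positive_transform (\<lambda>y. \<Phi> y * (\<Prod>K\<leftarrow>Ks. K y))"
  using assms
proof (induction Ks arbitrary: \<Phi>)
  case (Cons K Ks)
  have "positive_transform (\<lambda>y. (\<Phi> y * K y) * (\<Prod>K\<leftarrow>Ks. K y))"
    by (rule Cons.IH[OF positive_transform_mult]) (use Cons.prems in auto)
  then show ?case by (simp add: mult.assoc)
qed simp

section \<open>Gaussian regularisation of the inverse transform\<close>

text \<open>The substitution y = N u turns the integral into the characteristic function of the
  standard normal law at \<open>N * s\<close>.\<close>

lemma integral_cis_gaussian:
  fixes N s :: real
  assumes N: "N > 0"
  shows "(LINT y|lborel. cis (s * y) * complex_of_real (exp (- (y / N)\<^sup>2 / 2))) =
     complex_of_real (N * sqrt (2 * pi) * exp (- (N * s)\<^sup>2 / 2))"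
proof -
  have "(LINT y|lborel. cis (s * y) * complex_of_real (exp (- (y / N)\<^sup>2 / 2)))
      = N *\<^sub>R (LINT u|lborel. cis (s * (N * u)) * complex_of_real (exp (- u\<^sup>2 / 2)))"
    using lborel_integral_real_affine[of N "\<lambda>y. cis (s * y) * complex_of_real (exp (- (y / N)\<^sup>2 / 2))" 0] N
    by simp
  also have "(LINT u|lborel. cis (s * (N * u)) * complex_of_real (exp (- u\<^sup>2 / 2))) =
     (LINT u|lborel. complex_of_real (sqrt (2 * pi)) * (std_normal_density u *\<^sub>R iexp (N * s * u)))"
    by (rule Bochner_Integration.integral_cong)
       (auto simp: std_normal_density_def cis_conv_exp scaleR_conv_of_real mult_ac)
  also have "\<dots> = complex_of_real (sqrt (2 * pi)) * char std_normal_distribution (N * s)"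
    unfolding char_def
    by (subst integral_density) (simp_all add: normal_density_nonneg flip: integral_mult_right_zero)
  finally show ?thesis
    by (simp add: char_std_normal_distribution scaleR_conv_of_real)
qed

lemma integrable_gaussian_scaled:
  fixes N :: real
  assumes N: "N > 0"
  shows "integrable lborel (\<lambda>y. exp (- (y / N)\<^sup>2 / 2))"
proof -
  have "integrable lborel (\<lambda>u. sqrt (2 * pi) * std_normal_density u)"
    using integrable_std_normal_moment[of 0] by (intro integrable_mult_right) simp
  also have "(\<lambda>u. sqrt (2 * pi) * std_normal_density u) = (\<lambda>u::real. exp (- u\<^sup>2 / 2))"
    by (simp add: std_normal_density_def fun_eq_iff)
  finally have "integrable lborel (\<lambda>u::real. exp (- u\<^sup>2 / 2))" .
  then have "integrable lborel (\<lambda>y. exp (- (0 + inverse N * y)\<^sup>2 / 2))"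
    by (rule lborel_integrable_real_affine) (use N in auto)
  then show ?thesis by (simp only: divide_inverse_commute[of _ N] add_0)
qed

text \<open>No inversion formula is needed: with the Gaussian cut-off \<open>exp (- (y / N)\<^sup>2 / 2)\<close> the inverse
  transform at \<open>\<tau>\<close> is the average of \<open>k\<close> against a Gaussian of height of order \<open>N\<close> around
  \<open>ln x = \<tau>\<close>, hence bounded below uniformly in \<open>N\<close> by the contribution of \<open>\<tau> \<le> ln x \<le> \<tau> + 1 / N\<close>.\<close>

lemma positive_transform_log_mixture:
  fixes k :: "real \<Rightarrow> real"
  assumes k0: "\<And>x. k x \<ge> 0" and ki: "integrable lborel k" and Ki: "integrable lborel K"
    and Keq: "\<And>y. K y = (LINT x|lborel. complex_of_real (k x) * cis (y * ln x))"
    and low: "\<And>\<tau>. \<exists>m>0. \<forall>x>0. \<bar>ln x - \<tau>\<bar> \<le> 1 \<longrightarrow> m \<le> k x"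
  shows "positive_transform K"
proof -
  have [measurable]: "k \<in> borel_measurable borel" "K \<in> borel_measurable borel" using ki Ki by auto
  have "\<exists>p>0. (LINT y|lborel. K y * cis (- (\<tau> * y))) = complex_of_real p" for \<tau>
  proof -
    define L where "L = (LINT y|lborel. K y * cis (- (\<tau> * y)))"
    \<comment> \<open>Starting at 1 avoids division by 0 and keeps the window of width 1 / N inside
      the radius 1 of hypothesis \<open>low\<close>.\<close>
    define N where "N = (\<lambda>n::nat. real (Suc n))"
    have N: "N n > 0" "N n \<ge> 1" for n by (auto simp: N_def)
    define g where "g = (\<lambda>n x. k x * (N n * sqrt (2 * pi) * exp (- (N n * (ln x - \<tau>))\<^sup>2 / 2)))"
    define G where "G = (\<lambda>n. LINT y|lborel. K y * cis (- (\<tau> * y)) * complex_of_real (exp (- (y / N n)\<^sup>2 / 2)))"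
    have lim: "G \<longlonglongrightarrow> L"
      unfolding G_def L_def
    proof (rule integral_dominated_convergence)
      show "integrable lborel (\<lambda>y. norm (K y))" using Ki by simp
      show "AE y in lborel. (\<lambda>n. K y * cis (- (\<tau> * y)) * complex_of_real (exp (- (y / N n)\<^sup>2 / 2)))
          \<longlonglongrightarrow> K y * cis (- (\<tau> * y))"
      proof (intro AE_I2)
        fix y
        have "(\<lambda>n. y / N n) \<longlonglongrightarrow> 0" unfolding N_def
          by (rule LIMSEQ_Suc[OF lim_const_over_n])
        then have "(\<lambda>n. K y * cis (- (\<tau> * y)) * complex_of_real (exp (- (y / N n)\<^sup>2 / 2)))
          \<longlonglongrightarrow> K y * cis (- (\<tau> * y)) * complex_of_real (exp (- 0\<^sup>2 / 2))"
          by (intro tendsto_intros) auto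
        then show "(\<lambda>n. K y * cis (- (\<tau> * y)) * complex_of_real (exp (- (y / N n)\<^sup>2 / 2)))
          \<longlonglongrightarrow> K y * cis (- (\<tau> * y))" by simp
      qed
      fix n
      show "AE y in lborel. norm (K y * cis (- (\<tau> * y)) * complex_of_real (exp (- (y / N n)\<^sup>2 / 2))) \<le> norm (K y)"
        by (intro AE_I2) (auto simp: norm_mult intro!: mult_left_le)
    qed auto
    have G: "integrable lborel (g n) \<and> G n = complex_of_real (integral\<^sup>L lborel (g n))" for n
    proof -
      define f where "f = (\<lambda>(x, y). complex_of_real (k x) * (cis ((ln x - \<tau>) * y) * complex_of_real (exp (- (y / N n)\<^sup>2 / 2))))"
      have ge: "integrable lborel (\<lambda>y. exp (- (y / N n)\<^sup>2 / 2))"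
        by (rule integrable_gaussian_scaled[OF N(1)])
      have fint: "integrable (lborel \<Otimes>\<^sub>M lborel) f"
      proof (rule lborel_pair.Fubini_integrable)
        show "f \<in> borel_measurable (lborel \<Otimes>\<^sub>M lborel)" unfolding f_def by measurable
        have "(\<lambda>x. LINT y|lborel. norm (f (x, y))) = (\<lambda>x. k x * (LINT y|lborel. exp (- (y / N n)\<^sup>2 / 2)))"
          using k0 by (simp add: f_def norm_mult)
        then show "integrable lborel (\<lambda>x. LINT y|lborel. norm (f (x, y)))"
          using ki by simp
        show "AE x in lborel. integrable lborel (\<lambda>y. f (x, y))"
          unfolding f_def
          by (intro AE_I2) (auto intro!: integrable_mult_right Bochner_Integration.integrable_bound[OF ge]
              AE_I2 simp: norm_mult)
      qed
      have inner: "(LINT y|lborel. f (x, y)) = complex_of_real (g n x)" for x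
        using integral_cis_gaussian[OF N(1), of "ln x - \<tau>" n] by (simp add: f_def g_def)
      have i1: "integrable lborel (\<lambda>x. complex_of_real (g n x))"
        using lborel_pair.integrable_fst'[OF fint] inner by simp
      have "G n = (LINT y|lborel. LINT x|lborel. f (x, y))"
        unfolding G_def
      proof (rule Bochner_Integration.integral_cong[OF refl])
        fix y
        have "K y * cis (- (\<tau> * y)) * complex_of_real (exp (- (y / N n)\<^sup>2 / 2)) =
           (LINT x|lborel. (cis (- (\<tau> * y)) * complex_of_real (exp (- (y / N n)\<^sup>2 / 2))) * (complex_of_real (k x) * cis (y * ln x)))"
          by (subst integral_mult_right_zero) (simp add: Keq mult_ac)
        also have "\<dots> = (LINT x|lborel. f (x, y))"
        proof (rule Bochner_Integration.integral_cong[OF refl])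
          fix x
          have "cis (- (\<tau> * y)) * cis (y * ln x) = cis ((ln x - \<tau>) * y)"
            by (simp add: cis_mult algebra_simps)
          then show "(cis (- (\<tau> * y)) * complex_of_real (exp (- (y / N n)\<^sup>2 / 2))) * (complex_of_real (k x) * cis (y * ln x)) = f (x, y)"
            by (simp add: f_def mult_ac)
        qed
        finally show "K y * cis (- (\<tau> * y)) * complex_of_real (exp (- (y / N n)\<^sup>2 / 2)) = (LINT x|lborel. f (x, y))" .
      qed
      also have "\<dots> = (LINT x|lborel. LINT y|lborel. f (x, y))"
        using lborel_pair.Fubini_integral[of "\<lambda>x y. f (x, y)"] fint by simp
      also have "\<dots> = complex_of_real (integral\<^sup>L lborel (g n))"
        by (simp add: inner)
      finally show ?thesis using i1 by (simp only: complex_of_real_integrable_eq)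
    qed
    obtain m where m: "m > 0" "\<And>x. x > 0 \<Longrightarrow> \<bar>ln x - \<tau>\<bar> \<le> 1 \<Longrightarrow> m \<le> k x"
      using low[of \<tau>] by auto
    \<comment> \<open>On the window \<open>\<tau> \<le> ln x \<le> \<tau> + 1 / N\<close> the kernel
      is at least N sqrt (2 pi) exp (- 1 / 2) and \<open>k\<close> is at least \<open>m\<close>; in
      \<open>x\<close> the window has length at least exp \<tau> / N. The product of these three
      bounds is free of N.\<close>
    define \<delta> where "\<delta> = m * (sqrt (2 * pi) * exp (- 1 / 2)) * exp \<tau>"
    have \<delta>: "\<delta> > 0" using m by (simp add: \<delta>_def)
    have "\<delta> \<le> integral\<^sup>L lborel (g n)" for n
    proof -
      define J where "J = {exp \<tau> .. exp (\<tau> + 1 / N n)}"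
      define C where "C = m * (N n * sqrt (2 * pi) * exp (- 1 / 2))"
      have Jle: "exp \<tau> \<le> exp (\<tau> + 1 / N n)" using N(1)[of n] by simp
      have "\<delta> \<le> C * (exp (\<tau> + 1 / N n) - exp \<tau>)"
      proof -
        have "1 + 1 / N n \<le> exp (1 / N n)" by (rule exp_ge_add_one_self)
        then have "1 \<le> N n * (exp (1 / N n) - 1)" using N(1)[of n] by (simp add: field_simps)
        then have "\<delta> * 1 \<le> \<delta> * (N n * (exp (1 / N n) - 1))"
          using \<delta> by (intro mult_left_mono) auto
        then show ?thesis by (simp add: \<delta>_def C_def exp_add algebra_simps)
      qed
      also have "\<dots> = (LINT x|lborel. C * indicator J x)"
        using Jle by (simp add: J_def)
      also have "\<dots> \<le> integral\<^sup>L lborel (g n)"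
      proof (rule integral_mono)
        show "integrable lborel (\<lambda>x. C * indicator J x)"
          by (intro integrable_mult_right integrable_real_indicator)
             (simp_all add: J_def emeasure_lborel_Icc_eq)
        show "integrable lborel (g n)" using G by simp
        fix x
        show "C * indicator J x \<le> g n x"
        proof (cases "x \<in> J")
          case True
          then have x1: "exp \<tau> \<le> x" "x \<le> exp (\<tau> + 1 / N n)" by (auto simp: J_def)
          then have x0: "x > 0" using exp_gt_zero[of \<tau>] by linarith
          have x: "x > 0" "ln x \<ge> \<tau>" "ln x \<le> \<tau> + 1 / N n"
            using x1 x0 ln_le_cancel_iff[of x "exp (\<tau> + 1 / N n)"] by (simp_all add: ln_ge_iff)
          have "1 / N n \<le> 1" using N(2)[of n] by (simp add: divide_simps)
          with x have km: "m \<le> k x" by (intro m(2)) auto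
          have "N n * (ln x - \<tau>) \<le> 1" using x N(1)[of n] by (simp add: field_simps)
          moreover have "0 \<le> N n * (ln x - \<tau>)" using x N(1)[of n] by simp
          ultimately have "(N n * (ln x - \<tau>))\<^sup>2 \<le> 1" by (simp add: power_le_one)
          then have "exp (- 1 / 2) \<le> exp (- (N n * (ln x - \<tau>))\<^sup>2 / 2)" by simp
          then have "C \<le> g n x" unfolding C_def g_def
            using km m(1) N(1)[of n] k0[of x] by (intro mult_mono) auto
          then show ?thesis using True by simp
        next
          case False
          then show ?thesis using k0[of x] N(1)[of n] by (simp add: g_def)
        qed
      qed
      finally show ?thesis .
    qed
    then have "\<delta> \<le> Re (G n)" "Im (G n) = 0" for n using G[of n] by simp_all
    then have "\<delta> \<le> Re L" "Im L = 0"
      using LIMSEQ_le_const[OF tendsto_Re[OF lim], of \<delta>] LIMSEQ_unique[OF tendsto_Im[OF lim], of 0] by auto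
    then show ?thesis using \<delta> unfolding L_def[symmetric]
      by (intro exI[of _ "Re L"]) (auto simp: complex_eq_iff)
  qed
  then show ?thesis using Ki unfolding positive_transform_def by blast
qed

subsection \<open>Gamma functions on vertical lines\<close>

definition gamma_weight :: "real \<Rightarrow> real \<Rightarrow> real" where
  "gamma_weight a x = indicator {0<..} x * (x powr (a - 1) * exp (- x))"

definition beta_weight :: "real \<Rightarrow> real \<Rightarrow> real \<Rightarrow> real" where
  "beta_weight a e u = indicator {0<..<1} u * (u powr (a - 1) * (1 - u) powr (e - 1))"

lemma gamma_weight_nonneg: "gamma_weight a x \<ge> 0"
  by (simp add: gamma_weight_def)

lemma beta_weight_nonneg: "beta_weight a e x \<ge> 0"
  by (simp add: beta_weight_def)

lemma gamma_weight_measurable [measurable]: "gamma_weight a \<in> borel_measurable borel"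
  unfolding gamma_weight_def by measurable

lemma beta_weight_measurable [measurable]: "beta_weight a e \<in> borel_measurable borel"
  unfolding beta_weight_def by measurable

text \<open>Separates modulus and phase of the Mellin kernel, which brings Euler's integrals into
  the shape of \<open>positive_mixture\<close> with \<open>ln\<close> as \<open>\<theta>\<close>. It
  serves again, with \<open>1 - R\<close> and \<open>- y\<close>, for
  \<open>t powr (- s)\<close>.\<close>

lemma of_real_powr_Complex:
  assumes "x > 0"
  shows "complex_of_real x powr (Complex a y - 1) = complex_of_real (x powr (a - 1)) * cis (y * ln x)"
proof -
  have "complex_of_real x powr (Complex a y - 1) = exp (complex_of_real ((a - 1) * ln x) + \<i> * complex_of_real (y * ln x))"
    using assms by (simp add: powr_def Ln_of_real Complex_eq algebra_simps)
  also have "\<dots> = complex_of_real (x powr (a - 1)) * cis (y * ln x)"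
    using assms by (simp add: exp_add cis_conv_exp powr_def exp_of_real[symmetric] del: exp_of_real)
  finally show ?thesis .
qed

lemma gamma_weight_transform:
  assumes a: "a > 0"
  shows "integrable lborel (gamma_weight a)"
    and "(LINT x|lborel. complex_of_real (gamma_weight a x) * cis (y * ln x)) = Gamma (Complex a y)"
proof -
  have *: "integrable lborel (\<lambda>x. complex_of_real (gamma_weight a x) * cis (y * ln x))
    \<and> (LINT x|lborel. complex_of_real (gamma_weight a x) * cis (y * ln x)) = Gamma (Complex a y)" for y
  proof -
    let ?f = "\<lambda>t. complex_of_real t powr (Complex a y - 1) / complex_of_real (exp t)"
    have eq: "indicator {0<..} x *\<^sub>R ?f x = complex_of_real (gamma_weight a x) * cis (y * ln x)" for x
      by (cases "x > 0") (auto simp: gamma_weight_def of_real_powr_Complex exp_minus divide_inverse)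
    have "?f absolutely_integrable_on {0<..}"
      using a by (intro absolutely_integrable_Gamma_integral') simp
    \<comment> \<open>Absolute integrability refers to completed Lebesgue measure; Borel
      measurability of the integrand brings it down to \<open>lborel\<close>.\<close>
    then have i: "integrable lborel (\<lambda>x. complex_of_real (gamma_weight a x) * cis (y * ln x))"
      unfolding set_integrable_def eq by (subst (asm) integrable_completion) auto
    then have "set_integrable lborel {0<..} ?f"
      unfolding set_integrable_def eq .
    from set_borel_integral_eq_integral(2)[OF this]
    have "(LINT x|lborel. complex_of_real (gamma_weight a x) * cis (y * ln x)) = integral {0<..} ?f"
      unfolding set_lebesgue_integral_def eq .
    also have "\<dots> = Gamma (Complex a y)"
      using Gamma_integral_complex'[of "Complex a y"] a by (intro integral_unique) simp
    finally show ?thesis using i by simp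
  qed
  show "(LINT x|lborel. complex_of_real (gamma_weight a x) * cis (y * ln x)) = Gamma (Complex a y)"
    using * by blast
  show "integrable lborel (gamma_weight a)"
    using *[of 0] by (simp add: complex_of_real_integrable_eq)
qed

lemma integral_gamma_weight:
  assumes "a > 0"
  shows "integral\<^sup>L lborel (gamma_weight a) = Gamma a"
proof -
  have "complex_of_real (integral\<^sup>L lborel (gamma_weight a)) = Gamma (complex_of_real a)"
    using gamma_weight_transform(2)[OF assms, of 0] by (simp add: Complex_eq)
  then show ?thesis by (simp add: Gamma_complex_of_real)
qed

lemma positive_mixture_Gamma:
  assumes "a > 0"
  shows "positive_mixture (\<lambda>y. Gamma (Complex a y))"
  unfolding positive_mixture_def
  by (rule exI[of _ "gamma_weight a"], rule exI[of _ ln])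
     (use assms gamma_weight_transform[OF assms] in \<open>auto simp: gamma_weight_nonneg integral_gamma_weight\<close>)

lemma beta_weight_integrable:
  assumes "a > 0" "e > 0"
  shows "integrable lborel (beta_weight a e)"
proof -
  have "set_integrable lborel {0<..<1} (\<lambda>t. t powr (a - 1) * (1 - t) powr (e - 1))"
    by (rule set_integrable_subset[OF integrable_Beta[OF assms]]) auto
  then show ?thesis
    by (simp add: set_integrable_def beta_weight_def[abs_def])
qed

text \<open>Fubini for the convolution of two Gamma densities, as in the usual proof of the real Beta
  integral.\<close>

lemma beta_weight_transform:
  assumes a: "a > 0" and e: "e > 0"
  shows "Gamma (Complex a y) * complex_of_real (Gamma e) =
    Gamma (Complex (a + e) y) * (LINT u|lborel. complex_of_real (beta_weight a e u) * cis (y * ln u))"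
proof -
  define B where "B = (LINT u|lborel. complex_of_real (beta_weight a e u) * cis (y * ln u))"
  \<comment> \<open>\<open>w\<close> is the sum of the two Gamma variables \<open>x\<close> and
    \<open>w - x\<close>. The character sits on \<open>x\<close> alone, so the substitution x = w u
    splits it into one in \<open>w\<close> and one in \<open>u\<close>.\<close>
  define f where "f = (\<lambda>(x, w). complex_of_real (gamma_weight a x) * cis (y * ln x) * complex_of_real (gamma_weight e (w - x)))"
  have shift: "integrable lborel (\<lambda>w. gamma_weight e (w - x))" for x
    using lborel_integrable_real_affine[OF gamma_weight_transform(1)[OF e], of 1 "-x"] by simp
  have shift': "(LINT w|lborel. gamma_weight e (w - x)) = Gamma e" for x
    using lborel_integral_real_affine[of 1 "gamma_weight e" "-x"] integral_gamma_weight[OF e] by simp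
  have fint: "integrable (lborel \<Otimes>\<^sub>M lborel) f"
  proof (rule lborel_pair.Fubini_integrable)
    show "f \<in> borel_measurable (lborel \<Otimes>\<^sub>M lborel)" unfolding f_def by measurable
    have "(\<lambda>x. LINT w|lborel. norm (f (x, w))) = (\<lambda>x. gamma_weight a x * Gamma e)"
      by (simp add: f_def norm_mult gamma_weight_nonneg shift')
    then show "integrable lborel (\<lambda>x. LINT w|lborel. norm (f (x, w)))"
      using gamma_weight_transform(1)[OF a] by simp
    show "AE x in lborel. integrable lborel (\<lambda>w. f (x, w))"
      unfolding f_def using shift
      by (intro AE_I2) (auto intro!: integrable_mult_right simp: complex_of_real_integrable_eq)
  qed
  have inner: "(LINT x|lborel. f (x, w)) = complex_of_real (gamma_weight (a + e) w) * cis (y * ln w) * B" for w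
  proof (cases "w > 0")
    case True
    have pt: "f (0 + w * u, w) = (complex_of_real (inverse w * gamma_weight (a + e) w) * cis (y * ln w)) *
        (complex_of_real (beta_weight a e u) * cis (y * ln u))" for u
    proof (cases "0 < u \<and> u < 1")
      case True
      then have pos: "w * u > 0" "w - w * u > 0" using \<open>w > 0\<close> by auto
      have "gamma_weight a (w * u) * gamma_weight e (w - w * u) =
          (w * u) powr (a - 1) * exp (- (w * u)) * ((w * (1 - u)) powr (e - 1) * exp (- (w - w * u)))"
        using pos by (simp add: gamma_weight_def right_diff_distrib)
      also have "\<dots> = (w powr (a - 1) * w powr (e - 1)) * (exp (- (w * u)) * exp (- (w - w * u))) * (u powr (a - 1) * (1 - u) powr (e - 1))"
        using True \<open>w > 0\<close> by (simp add: powr_mult)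
      also have "exp (- (w * u)) * exp (- (w - w * u)) = exp (- w)"
        by (simp add: exp_add[symmetric])
      \<comment> \<open>The powers of \<open>w\<close> leave a surplus \<open>inverse w\<close>,
        which the factor \<open>w\<close> of the substitution absorbs.\<close>
      also have "w powr (a - 1) * w powr (e - 1) = inverse w * w powr (a + e - 1)"
        using \<open>w > 0\<close> by (simp add: powr_add[symmetric] powr_diff field_simps)
      finally have r: "gamma_weight a (w * u) * gamma_weight e (w - w * u) =
          inverse w * gamma_weight (a + e) w * beta_weight a e u"
        using True \<open>w > 0\<close> by (simp add: gamma_weight_def beta_weight_def)
      have c: "cis (y * ln (w * u)) = cis (y * ln w) * cis (y * ln u)"
        using True \<open>w > 0\<close> by (simp add: ln_mult cis_mult distrib_left)
      have "f (0 + w * u, w) = complex_of_real (gamma_weight a (w * u) * gamma_weight e (w - w * u)) * cis (y * ln (w * u))"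
        by (simp add: f_def)
      then show ?thesis unfolding r c by simp
    next
      case False
      then have "\<not> 0 < w * u \<or> \<not> 0 < w - w * u"
        using \<open>w > 0\<close> by (auto simp: zero_less_mult_iff)
      then show ?thesis using False by (auto simp: f_def gamma_weight_def beta_weight_def)
    qed
    have "(LINT x|lborel. f (x, w)) = w *\<^sub>R (LINT u|lborel. f (0 + w * u, w))"
      using lborel_integral_real_affine[of w "\<lambda>x. f (x, w)" 0] True by simp
    also have "\<dots> = w *\<^sub>R ((complex_of_real (inverse w * gamma_weight (a + e) w) * cis (y * ln w)) * B)"
      unfolding pt B_def by (subst integral_mult_right_zero) simp
    also have "\<dots> = complex_of_real (gamma_weight (a + e) w) * cis (y * ln w) * B"
      using True by (simp add: scaleR_conv_of_real)
    finally show ?thesis .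
  next
    case False
    then have "f (x, w) = 0" for x by (auto simp: f_def gamma_weight_def indicator_def)
    then show ?thesis using False by (simp add: gamma_weight_def)
  qed
  have "Gamma (Complex a y) * complex_of_real (Gamma e) = (LINT x|lborel. LINT w|lborel. f (x, w))"
  proof -
    have "(LINT w|lborel. f (x, w)) = (complex_of_real (gamma_weight a x) * cis (y * ln x)) * complex_of_real (Gamma e)" for x
      by (simp add: f_def shift')
    then show ?thesis by (simp add: gamma_weight_transform(2)[OF a])
  qed
  also have "\<dots> = (LINT w|lborel. LINT x|lborel. f (x, w))"
    using lborel_pair.Fubini_integral[of "\<lambda>x w. f (x, w)"] fint by simp
  also have "\<dots> = Gamma (Complex (a + e) y) * B"
    using gamma_weight_transform(2)[of "a + e" y] a e by (simp add: inner)
  finally show ?thesis by (simp add: B_def)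
qed

lemma Complex_not_nonpos_Ints:
  assumes "a > 0 \<or> y \<noteq> 0"
  shows "Complex a y \<notin> \<int>\<^sub>\<le>\<^sub>0"
proof
  assume "Complex a y \<in> \<int>\<^sub>\<le>\<^sub>0"
  then obtain n where "Complex a y = - of_nat n" by (elim nonpos_Ints_cases')
  then show False using assms by (auto simp: complex_eq_iff)
qed

text \<open>Euler's Beta integral: the mixing density is \<open>beta_weight a e / Gamma e\<close>,
  integrable near u = 1 because e > 0. Its mass is read off at y = 0, where the quotient consists of
  positive Gamma values.\<close>

lemma positive_mixture_Gamma_ratio:
  assumes a: "a > 0" and e: "e > 0"
  shows "positive_mixture (\<lambda>y. Gamma (Complex a y) * rGamma (Complex (a + e) y))"
proof -
  have eq: "Gamma (Complex a y) * rGamma (Complex (a + e) y) =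
      (LINT u|lborel. complex_of_real (beta_weight a e u / Gamma e) * cis (y * ln u))" for y
  proof -
    have g: "Gamma e \<noteq> 0" using Gamma_real_pos[OF e] by simp
    have "Gamma (Complex (a + e) y) \<noteq> 0"
      using Complex_not_nonpos_Ints[of "a + e" y] a e by (simp add: Gamma_eq_zero_iff)
    then have "Gamma (Complex a y) * rGamma (Complex (a + e) y) =
      (LINT u|lborel. complex_of_real (beta_weight a e u) * cis (y * ln u)) / complex_of_real (Gamma e)"
      using beta_weight_transform[OF a e, of y] g
      by (simp add: rGamma_inverse_Gamma field_simps)
    also have "\<dots> = (LINT u|lborel. (complex_of_real (beta_weight a e u) * cis (y * ln u)) / complex_of_real (Gamma e))"
      by simp
    finally show ?thesis by simp
  qed
  have int: "integrable lborel (\<lambda>u. beta_weight a e u / Gamma e)"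
    using beta_weight_integrable[OF a e] by simp
  have "complex_of_real (LINT u|lborel. beta_weight a e u / Gamma e) =
      complex_of_real (Gamma a * rGamma (a + e))"
    using eq[of 0] by (simp add: Complex_eq Gamma_complex_of_real rGamma_complex_of_real
        flip: of_real_add)
  then have "(LINT u|lborel. beta_weight a e u / Gamma e) = Gamma a * rGamma (a + e)"
    by (simp only: of_real_eq_iff)
  also have "\<dots> > 0"
    using a e by (simp add: Gamma_real_pos rGamma_inverse_Gamma)
  finally have pos: "(LINT u|lborel. beta_weight a e u / Gamma e) > 0" .
  show ?thesis unfolding positive_mixture_def
    by (rule exI[of _ "\<lambda>u. beta_weight a e u / Gamma e"], rule exI[of _ ln])
       (use eq int pos e in \<open>auto simp: beta_weight_nonneg Gamma_real_pos less_imp_le\<close>)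
qed

section \<open>Bounds for Gamma and its quotients on vertical strips\<close>

text \<open>A shift by \<open>N\<close> moves a strip starting at real part \<open>A\<close> to
  where the mixture representations apply. At least two steps are asked for because each contributes
  one factor of the height to the decay.\<close>

lemma ex_nat_shift: "\<exists>N\<ge>2. A + real N \<ge> 1"
  by (rule exI[of _ "nat \<lceil>1 - A\<rceil> + 2"]) (auto, linarith)

text \<open>\<open>Gamma s\<close> is \<open>Gamma (s + N)\<close> divided by
  \<open>pochhammer s N\<close>. Each of the N factors of the denominator has modulus at least that
  of \<open>Im s\<close>, and the numerator is dominated by its value at the real point, which stays
  in a compact interval.\<close>

lemma Gamma_vertical_decay:
  "\<exists>C. \<forall>s. A \<le> Re s \<longrightarrow> Re s \<le> B \<longrightarrow> \<bar>Im s\<bar> \<ge> 1 \<longrightarrow> norm (Gamma s) * (Im s)\<^sup>2 \<le> C"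
proof -
  obtain N where N: "N \<ge> 2" "A + real N \<ge> 1" using ex_nat_shift by blast
  have "compact (Gamma ` {A + real N..B + real N})"
    using N by (intro compact_continuous_image continuous_intros) (auto elim!: nonpos_Ints_cases)
  then obtain C where C: "\<And>x. A + real N \<le> x \<Longrightarrow> x \<le> B + real N \<Longrightarrow> \<bar>Gamma x\<bar> \<le> C"
    using compact_imp_bounded bounded_iff by (metis (no_types, lifting) atLeastAtMost_iff image_eqI real_norm_def)
  have "norm (Gamma s) * (Im s)\<^sup>2 \<le> C" if s: "A \<le> Re s" "Re s \<le> B" "\<bar>Im s\<bar> \<ge> 1" for s
  proof -
    have nn: "s \<notin> \<int>\<^sub>\<le>\<^sub>0" using Complex_not_nonpos_Ints[of "Re s" "Im s"] s by (cases "Im s = 0") auto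
    have Gs: "Gamma s \<noteq> 0" using nn by (simp add: Gamma_eq_zero_iff)
    have eq: "norm (pochhammer s N) * norm (Gamma s) = norm (Gamma (s + of_nat N))"
      using pochhammer_Gamma[OF nn, of N] Gs by (simp add: norm_divide)
    have "\<bar>Im s\<bar> ^ 2 \<le> \<bar>Im s\<bar> ^ N" using N s by (intro power_increasing) auto
    also have "\<dots> = (\<Prod>i<N. \<bar>Im s\<bar>)" by simp
    also have "\<dots> \<le> (\<Prod>i<N. norm (s + of_nat i))"
    proof (rule prod_mono, safe)
      fix i show "\<bar>Im s\<bar> \<le> norm (s + of_nat i)" using abs_Im_le_cmod[of "s + of_nat i"] by simp
    qed auto
    also have "\<dots> = norm (pochhammer s N)"
      by (simp add: pochhammer_prod prod_norm[symmetric] atLeast0LessThan)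
    finally have p: "(Im s)\<^sup>2 \<le> norm (pochhammer s N)" by simp
    have "norm (Gamma s) * (Im s)\<^sup>2 \<le> norm (Gamma s) * norm (pochhammer s N)"
      by (intro mult_left_mono p) auto
    also have "\<dots> = norm (Gamma (Complex (Re s + real N) (Im s)))"
      using eq by (simp add: mult.commute complex_eq_iff Complex_eq algebra_simps)
         (metis complex_eq add.assoc add.commute)
    also have "\<dots> \<le> norm (Gamma (Complex (Re s + real N) 0))"
      using norm_positive_mixture_le[OF positive_mixture_Gamma, of "Re s + real N" "Im s"] N s by simp
    also have "\<dots> = \<bar>Gamma (Re s + real N)\<bar>"
      by (simp add: complex_of_real_def[symmetric] Gamma_complex_of_real del: of_real_add)
    also have "\<dots> \<le> C" using s by (intro C) auto
    finally show ?thesis .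
  qed
  then show ?thesis by blast
qed

text \<open>Shifting both arguments by N leaves a mixture, bounded by its real value, times a
  quotient of Pochhammer symbols. As each s + i has modulus at least 1, adding e enlarges it at most
  by the factor 1 + e; hence the constant (1 + e) ^ N.\<close>

lemma Gamma_ratio_vertical_bound:
  assumes e: "e > 0"
  shows "\<exists>C. \<forall>s. A \<le> Re s \<longrightarrow> Re s \<le> B \<longrightarrow> \<bar>Im s\<bar> \<ge> 1 \<longrightarrow>
     norm (Gamma s * rGamma (s + of_real e)) \<le> C"
proof -
  obtain N where N: "N \<ge> 2" "A + real N \<ge> 1" using ex_nat_shift by blast
  have "compact ((\<lambda>x. Gamma x * rGamma (x + e)) ` {A + real N..B + real N})"
    using N by (intro compact_continuous_image continuous_intros
        continuous_on_compose2[OF continuous_on_rGamma[of UNIV]]) (auto elim!: nonpos_Ints_cases)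
  then obtain C where C: "\<And>x. A + real N \<le> x \<Longrightarrow> x \<le> B + real N \<Longrightarrow> \<bar>Gamma x * rGamma (x + e)\<bar> \<le> C"
    using compact_imp_bounded bounded_iff by (metis (no_types, lifting) atLeastAtMost_iff image_eqI real_norm_def)
  have "norm (Gamma s * rGamma (s + of_real e)) \<le> (1 + e) ^ N * C"
    if s: "A \<le> Re s" "Re s \<le> B" "\<bar>Im s\<bar> \<ge> 1" for s
  proof -
    have nn: "s \<notin> \<int>\<^sub>\<le>\<^sub>0" using Complex_not_nonpos_Ints[of "Re s" "Im s"] s by (cases "Im s = 0") auto
    have Gs: "Gamma s \<noteq> 0" using nn by (simp add: Gamma_eq_zero_iff)
    have ge1: "norm (s + of_nat i) \<ge> 1" for i
      using abs_Im_le_cmod[of "s + of_nat i"] s by simp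
    have "norm (pochhammer (s + of_real e) N) = (\<Prod>i<N. norm (s + of_real e + of_nat i))"
      by (simp add: pochhammer_prod prod_norm[symmetric] atLeast0LessThan)
    also have "\<dots> \<le> (\<Prod>i<N. (1 + e) * norm (s + of_nat i))"
    proof (rule prod_mono, safe)
      fix i
      have "norm (s + of_real e + of_nat i) \<le> norm (s + of_nat i) + e"
        using norm_triangle_ineq[of "s + of_nat i" "of_real e"] e by (simp add: add_ac)
      also have "\<dots> \<le> norm (s + of_nat i) + e * norm (s + of_nat i)"
        using ge1[of i] e by simp
      finally show "norm (s + of_real e + of_nat i) \<le> (1 + e) * norm (s + of_nat i)"
        by (simp add: algebra_simps)
    qed auto
    also have "\<dots> = (1 + e) ^ N * norm (pochhammer s N)"
      by (simp add: prod.distrib pochhammer_prod prod_norm[symmetric] atLeast0LessThan)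
    finally have p: "norm (pochhammer (s + of_real e) N) \<le> (1 + e) ^ N * norm (pochhammer s N)" .
    let ?x = "Re s + real N"
    have "norm (Gamma s * rGamma (s + of_real e)) =
        norm (Gamma s) * norm (pochhammer (s + of_real e) N) * norm (rGamma (s + of_real e + of_nat N))"
      by (subst pochhammer_rGamma[of "s + of_real e" N]) (simp add: norm_mult mult_ac)
    also have "\<dots> \<le> norm (Gamma s) * ((1 + e) ^ N * norm (pochhammer s N)) * norm (rGamma (s + of_real e + of_nat N))"
      by (intro mult_right_mono mult_left_mono p) auto
    also have "\<dots> = (1 + e) ^ N * norm (Gamma (s + of_nat N) * rGamma (s + of_real e + of_nat N))"
      using pochhammer_Gamma[OF nn, of N] Gs by (simp add: norm_mult norm_divide mult_ac)
    also have "Gamma (s + of_nat N) * rGamma (s + of_real e + of_nat N) =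
        Gamma (Complex ?x (Im s)) * rGamma (Complex (?x + e) (Im s))"
    proof -
      have "s + of_nat N = Complex ?x (Im s)" "s + of_real e + of_nat N = Complex (?x + e) (Im s)"
        by (auto simp: complex_eq_iff)
      then show ?thesis by simp
    qed
    also have "norm \<dots> \<le> norm (Gamma (Complex ?x 0) * rGamma (Complex (?x + e) 0))"
      using norm_positive_mixture_le[OF positive_mixture_Gamma_ratio[OF _ e], of ?x "Im s"] N s by simp
    also have "\<dots> = \<bar>Gamma ?x * rGamma (?x + e)\<bar>"
      by (simp add: complex_of_real_def[symmetric] Gamma_complex_of_real rGamma_complex_of_real norm_mult abs_mult
          del: of_real_add)
    also have "\<dots> \<le> C" using s by (intro C) auto
    finally show ?thesis using e by (simp add: mult_left_mono)
  qed
  then show ?thesis by blast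
qed

text \<open>Supplies hypothesis \<open>low\<close> of the Gaussian argument: the window is the
  compact interval from exp (\<tau> - 1) to exp (\<tau> + 1), on which the continuous positive
  density attains its minimum.\<close>

lemma gamma_weight_locally_bounded_below:
  "\<exists>m>0. \<forall>x>0. \<bar>ln x - \<tau>\<bar> \<le> 1 \<longrightarrow> m \<le> gamma_weight a x"
proof -
  have J: "x > 0" if "x \<in> {exp (\<tau> - 1)..exp (\<tau> + 1)}" for x
    using that exp_gt_zero[of "\<tau> - 1"] by (auto simp del: exp_gt_zero intro: less_le_trans)
  have "continuous_on {exp (\<tau> - 1)..exp (\<tau> + 1)} (\<lambda>x. x powr (a - 1) * exp (- x))"
    by (intro continuous_intros) (use J in force)
  then obtain x0 where x0: "x0 \<in> {exp (\<tau> - 1)..exp (\<tau> + 1)}"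
      "\<And>x. x \<in> {exp (\<tau> - 1)..exp (\<tau> + 1)} \<Longrightarrow> x0 powr (a - 1) * exp (- x0) \<le> x powr (a - 1) * exp (- x)"
    using continuous_attains_inf[of "{exp (\<tau> - 1)..exp (\<tau> + 1)}" "\<lambda>x. x powr (a - 1) * exp (- x)"] by auto
  have "x0 powr (a - 1) * exp (- x0) \<le> gamma_weight a x" if "x > 0" "\<bar>ln x - \<tau>\<bar> \<le> 1" for x
  proof -
    have "exp (\<tau> - 1) \<le> exp (ln x)" "exp (ln x) \<le> exp (\<tau> + 1)" using that unfolding exp_le_cancel_iff by auto
    then show ?thesis using x0(2)[of x] that by (simp add: gamma_weight_def)
  qed
  then show ?thesis using J[OF x0(1)] by (intro exI[of _ "x0 powr (a - 1) * exp (- x0)"]) auto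
qed

lemma integrable_Gamma_vertical:
  assumes a: "a > 0"
  shows "integrable lborel (\<lambda>y. Gamma (Complex a y))"
proof -
  obtain C0 where C0: "\<And>s. a \<le> Re s \<Longrightarrow> Re s \<le> a \<Longrightarrow> \<bar>Im s\<bar> \<ge> 1 \<Longrightarrow> norm (Gamma s) * (Im s)\<^sup>2 \<le> C0"
    using Gamma_vertical_decay[of a a] by blast
  have G: "norm (Gamma (Complex a y)) \<le> norm (Gamma (Complex a 0))" for y
    using norm_positive_mixture_le[OF positive_mixture_Gamma[OF a]] .
  \<comment> \<open>For heights at least 1 the factor \<open>1 + y\<^sup>2\<close> is at most
    \<open>2 * y\<^sup>2\<close> and the quadratic decay applies; for smaller ones it is at most 2
    and the value at height 0 dominates.\<close>
  define D where "D = 2 * max C0 (norm (Gamma (Complex a 0)))"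
  have int: "integrable lborel (\<lambda>y::real. D * inverse (1 + y\<^sup>2))"
    using integrable_inverse_1_plus_square by (simp add: set_integrable_def)
  have "norm (Gamma (Complex a y)) \<le> D * inverse (1 + y\<^sup>2)" for y
  proof -
    have "norm (Gamma (Complex a y)) * (1 + y\<^sup>2) \<le> D"
    proof (cases "\<bar>y\<bar> \<ge> 1")
      case True
      then have "y\<^sup>2 \<ge> 1" by (metis abs_one abs_le_square_iff one_power2)
      then have "norm (Gamma (Complex a y)) * (1 + y\<^sup>2) \<le> norm (Gamma (Complex a y)) * (2 * y\<^sup>2)"
        by (intro mult_left_mono) auto
      also have "\<dots> \<le> 2 * C0" using C0[of "Complex a y"] True by simp
      finally show ?thesis by (simp add: D_def)
    next
      case False
      then have "y\<^sup>2 \<le> 1" by (simp add: abs_square_le_1)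
      then have "norm (Gamma (Complex a y)) * (1 + y\<^sup>2) \<le> norm (Gamma (Complex a 0)) * 2"
        using G[of y] by (intro mult_mono) auto
      then show ?thesis by (simp add: D_def)
    qed
    moreover have "1 + y\<^sup>2 > 0" by (simp add: add_pos_nonneg)
    ultimately show ?thesis by (simp add: field_simps)
  qed
  then have bd: "norm (Gamma (Complex a y)) \<le> norm (D * inverse (1 + y\<^sup>2))" for y
    by (rule order_trans) simp
  \<comment> \<open>Measurability in \<open>y\<close> is inherited from the parameter
    integral.\<close>
  have "(\<lambda>y. LINT x|lborel. complex_of_real (gamma_weight a x) * cis (y * ln x)) \<in> borel_measurable lborel"
    by measurable
  then have "(\<lambda>y. Gamma (Complex a y)) \<in> borel_measurable lborel"
    by (simp add: gamma_weight_transform(2)[OF a])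
  then show ?thesis by (rule Bochner_Integration.integrable_bound[OF int]) (use bd in auto)
qed

lemma positive_transform_Gamma:
  assumes a: "a > 0"
  shows "positive_transform (\<lambda>y. Gamma (Complex a y))"
  by (rule positive_transform_log_mixture[OF gamma_weight_nonneg gamma_weight_transform(1)[OF a]
        integrable_Gamma_vertical[OF a] gamma_weight_transform(2)[OF a, symmetric]
        gamma_weight_locally_bounded_below])

text \<open>The restriction on \<open>Im s\<close> cuts out the real axis, where the Gamma factors
  have all their poles. The property passes to products, so quadratic decay of one factor is enough
  for the whole integrand.\<close>

definition strip_bounded :: "(complex \<Rightarrow> complex) \<Rightarrow> bool" where
  "strip_bounded F \<longleftrightarrow> (\<forall>A B. \<exists>C. \<forall>s. A \<le> Re s \<longrightarrow> Re s \<le> B \<longrightarrow> \<bar>Im s\<bar> \<ge> 1 \<longrightarrow> norm (F s) \<le> C)"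

lemma strip_boundedD:
  assumes "strip_bounded F"
  obtains C where "C \<ge> 0" "\<And>s. A \<le> Re s \<Longrightarrow> Re s \<le> B \<Longrightarrow> \<bar>Im s\<bar> \<ge> 1 \<Longrightarrow> norm (F s) \<le> C"
proof -
  obtain C where "\<And>s. A \<le> Re s \<Longrightarrow> Re s \<le> B \<Longrightarrow> \<bar>Im s\<bar> \<ge> 1 \<Longrightarrow> norm (F s) \<le> C"
    using assms unfolding strip_bounded_def by blast
  then show ?thesis by (intro that[of "max C 0"]) (auto simp: le_max_iff_disj)
qed

lemma strip_bounded_mult:
  assumes "strip_bounded F" "strip_bounded G"
  shows "strip_bounded (\<lambda>s. F s * G s)"
  unfolding strip_bounded_def
proof (intro allI)
  fix A B
  obtain C where C: "C \<ge> 0" "\<And>s. A \<le> Re s \<Longrightarrow> Re s \<le> B \<Longrightarrow> \<bar>Im s\<bar> \<ge> 1 \<Longrightarrow> norm (F s) \<le> C"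
    using strip_boundedD[OF assms(1)] by blast
  obtain D where D: "D \<ge> 0" "\<And>s. A \<le> Re s \<Longrightarrow> Re s \<le> B \<Longrightarrow> \<bar>Im s\<bar> \<ge> 1 \<Longrightarrow> norm (G s) \<le> D"
    using strip_boundedD[OF assms(2)] by blast
  show "\<exists>C. \<forall>s. A \<le> Re s \<longrightarrow> Re s \<le> B \<longrightarrow> \<bar>Im s\<bar> \<ge> 1 \<longrightarrow> norm (F s * G s) \<le> C"
    using C D by (intro exI[of _ "C * D"]) (auto simp: norm_mult intro!: mult_mono)
qed

lemma strip_bounded_prod_list:
  assumes "\<And>F. F \<in> set Fs \<Longrightarrow> strip_bounded F"
  shows "strip_bounded (\<lambda>s. \<Prod>F\<leftarrow>Fs. F s)"
  using assms
proof (induction Fs)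
  case Nil
  show ?case by (auto simp: strip_bounded_def)
next
  case (Cons F Fs)
  then show ?case by (simp add: strip_bounded_mult)
qed

lemma strip_bounded_shift:
  assumes "strip_bounded F"
  shows "strip_bounded (\<lambda>s. F (of_real a + s))"
  unfolding strip_bounded_def
proof (intro allI)
  fix A B
  obtain C where C: "\<And>s. A + a \<le> Re s \<Longrightarrow> Re s \<le> B + a \<Longrightarrow> \<bar>Im s\<bar> \<ge> 1 \<Longrightarrow> norm (F s) \<le> C"
    using strip_boundedD[OF assms] by blast
  show "\<exists>C. \<forall>s. A \<le> Re s \<longrightarrow> Re s \<le> B \<longrightarrow> \<bar>Im s\<bar> \<ge> 1 \<longrightarrow> norm (F (of_real a + s)) \<le> C"
    by (intro exI[of _ C] allI impI C) auto
qed

lemma strip_bounded_uminus: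
  assumes "strip_bounded F"
  shows "strip_bounded (\<lambda>s. F (- s))"
  unfolding strip_bounded_def
proof (intro allI)
  fix A B
  obtain C where C: "\<And>s. - B \<le> Re s \<Longrightarrow> Re s \<le> - A \<Longrightarrow> \<bar>Im s\<bar> \<ge> 1 \<Longrightarrow> norm (F s) \<le> C"
    using strip_boundedD[OF assms] by blast
  show "\<exists>C. \<forall>s. A \<le> Re s \<longrightarrow> Re s \<le> B \<longrightarrow> \<bar>Im s\<bar> \<ge> 1 \<longrightarrow> norm (F (- s)) \<le> C"
    by (intro exI[of _ C] allI impI C) auto
qed

lemma strip_bounded_Gamma: "strip_bounded Gamma"
  unfolding strip_bounded_def
proof (intro allI)
  fix A B
  obtain C where C: "\<And>s. A \<le> Re s \<Longrightarrow> Re s \<le> B \<Longrightarrow> \<bar>Im s\<bar> \<ge> 1 \<Longrightarrow> norm (Gamma s) * (Im s)\<^sup>2 \<le> C"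
    using Gamma_vertical_decay by blast
  have "norm (Gamma s) \<le> C" if "A \<le> Re s" "Re s \<le> B" "\<bar>Im s\<bar> \<ge> 1" for s
  proof -
    have "(Im s)\<^sup>2 \<ge> 1" using that(3) by (metis abs_one abs_le_square_iff one_power2)
    then have "norm (Gamma s) * 1 \<le> norm (Gamma s) * (Im s)\<^sup>2" by (intro mult_left_mono) auto
    then show ?thesis using C[OF that] by simp
  qed
  then show "\<exists>C. \<forall>s. A \<le> Re s \<longrightarrow> Re s \<le> B \<longrightarrow> \<bar>Im s\<bar> \<ge> 1 \<longrightarrow> norm (Gamma s) \<le> C" by blast
qed

lemma strip_bounded_Gamma_ratio:
  assumes "c < d"
  shows "strip_bounded (\<lambda>s. Gamma (of_real c + s) * rGamma (of_real d + s))"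
proof -
  have "strip_bounded (\<lambda>s. Gamma s * rGamma (s + of_real (d - c)))"
    using Gamma_ratio_vertical_bound[of "d - c"] assms by (simp add: strip_bounded_def)
  from strip_bounded_shift[OF this, of c] show ?thesis
    by (simp add: algebra_simps)
qed

subsection \<open>Independence of the contour\<close>

lemma vertical_contour_continuous_on:
  assumes "vertical_contour \<gamma> g"
  shows "continuous_on A g"
proof -
  have "isCont g t" for t
  proof -
    have "g piecewise_C1_differentiable_on {t - 1..t + 1}"
      using assms by (auto simp: vertical_contour_def)
    then have "continuous_on {t - 1..t + 1} g"
      by (simp add: piecewise_C1_differentiable_on_def)
    then show ?thesis by (rule continuous_on_interior) auto
  qed
  then show ?thesis by (simp add: continuous_at_imp_continuous_on)
qed

lemma vertical_contour_Re_bounded: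
  assumes "vertical_contour \<gamma> g"
  obtains M where "\<And>t. \<bar>Re (g t)\<bar> \<le> M"
proof -
  have *: "((\<lambda>t. Re (g t)) \<longlongrightarrow> \<gamma>) at_bot" "((\<lambda>t. Re (g t)) \<longlongrightarrow> \<gamma>) at_top"
    using assms by (auto simp: vertical_contour_def)
  obtain T1 where T1: "\<And>t. t \<le> T1 \<Longrightarrow> dist (Re (g t)) \<gamma> < 1"
    using tendstoD[OF *(1), of 1] by (auto simp: eventually_at_bot_linorder)
  obtain T2 where T2: "\<And>t. t \<ge> T2 \<Longrightarrow> dist (Re (g t)) \<gamma> < 1"
    using tendstoD[OF *(2), of 1] by (auto simp: eventually_at_top_linorder)
  have "compact ((\<lambda>t. Re (g t)) ` {T1..T2})"
    by (intro compact_continuous_image continuous_intros vertical_contour_continuous_on[OF assms] compact_Icc)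
  then obtain C where C: "\<And>t. T1 \<le> t \<Longrightarrow> t \<le> T2 \<Longrightarrow> \<bar>Re (g t)\<bar> \<le> C"
    using compact_imp_bounded bounded_iff by (metis (no_types, lifting) atLeastAtMost_iff image_eqI real_norm_def)
  have "\<bar>Re (g t)\<bar> \<le> max C (\<bar>\<gamma>\<bar> + 1)" for t
    using T1[of t] T2[of t] C[of t] by (cases "t \<le> T1"; cases "t \<ge> T2") (auto simp: dist_real_def)
  then show ?thesis by (rule that)
qed

text \<open>Both ends of the curve leave every horizontal band, so near a given point only a compact
  arc matters. Openness of the complement later turns connected components into path
  components.\<close>

lemma vertical_contour_closed_range:
  assumes "vertical_contour \<gamma> g"
  shows "closed (range g)"
  unfolding closed_def
proof (rule openI)
  fix z assume z: "z \<in> - range g"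
  have *: "filterlim (\<lambda>t. Im (g t)) at_bot at_bot" "filterlim (\<lambda>t. Im (g t)) at_top at_top"
    using assms by (auto simp: vertical_contour_def)
  obtain T1 where T1: "\<And>t. t \<le> T1 \<Longrightarrow> Im (g t) \<le> Im z - 1"
    using *(1) by (auto simp: filterlim_at_bot eventually_at_bot_linorder)
  obtain T2 where T2: "\<And>t. t \<ge> T2 \<Longrightarrow> Im (g t) \<ge> Im z + 1"
    using *(2) by (auto simp: filterlim_at_top eventually_at_top_linorder)
  have "open (ball z 1 \<inter> - g ` {T1..T2})"
    by (intro open_Int open_ball open_Compl compact_imp_closed compact_continuous_image
        vertical_contour_continuous_on[OF assms] compact_Icc)
  moreover have "z \<in> ball z 1 \<inter> - g ` {T1..T2}" using z by auto
  moreover have "ball z 1 \<inter> - g ` {T1..T2} \<subseteq> - range g"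
  proof safe
    fix t assume 1: "g t \<in> ball z 1" and 2: "g t \<notin> g ` {T1..T2}"
    have "t < T1 \<or> t > T2" using 2 by force
    moreover have "\<bar>Im (g t) - Im z\<bar> < 1"
      using 1 abs_Im_le_cmod[of "g t - z"] by (simp add: dist_norm norm_minus_commute)
    ultimately show False using T1[of t] T2[of t] by auto
  qed
  ultimately show "\<exists>e>0. ball z e \<subseteq> - range g"
    by (meson open_contains_ball order_trans)
qed

lemma valid_path_arc:
  assumes "vertical_contour \<gamma> g" "a < b"
  shows "valid_path (subpath a b g)"
proof -
  let ?f = "\<lambda>x. ((b - a) * x + a)"
  have "(g \<circ> ?f) piecewise_C1_differentiable_on {0..1}"
  proof (rule piecewise_C1_differentiable_compose)
    show "?f piecewise_C1_differentiable_on {0..1}"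
      by (simp add: C1_differentiable_imp_piecewise)
    show "g piecewise_C1_differentiable_on ?f ` {0..1}"
      using assms by (auto simp: vertical_contour_def image_affinity_atLeastAtMost)
    show "\<And>x. finite ({0..1} \<inter> ?f -` {x})"
      using assms(2) by (simp add: Int_commute [of "{0..1}"] inj_on_def crossproduct_eq finite_vimage_IntI)
  qed
  then show ?thesis by (simp add: valid_path_def subpath_def o_def)
qed

text \<open>Bridges the improper integral, parametrised by \<open>g\<close> itself, and contour
  integrals over the unit interval: an affine change of parameter, with the chain rule used off the
  finite set where \<open>g\<close> may fail to be differentiable.\<close>

lemma integral_arc:
  assumes vc: "vertical_contour \<gamma> g" and ab: "a < b" and f: "f contour_integrable_on (subpath a b g)"
  shows "integral {a..b} (\<lambda>t. f (g t) * vector_derivative g (at t)) = contour_integral (subpath a b g) f"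
proof -
  have "g piecewise_C1_differentiable_on {a..b}"
    using vc ab by (auto simp: vertical_contour_def)
  then obtain S where fs: "finite S" and S: "\<And>x. x \<in> {a..b} - S \<Longrightarrow> g differentiable at x"
    unfolding piecewise_C1_differentiable_on_def C1_differentiable_on_eq by blast
  let ?h = "subpath a b g"
  have vd: "vector_derivative ?h (at ((t - a) / (b - a))) = (b - a) *\<^sub>R vector_derivative g (at t)"
    if t: "t \<in> {a..b} - S" for t
  proof -
    have e: "(b - a) * ((t - a) / (b - a)) + a = t" using ab by simp
    have "((\<lambda>x. (b - a) * x + a) has_vector_derivative (b - a)) (at ((t - a) / (b - a)))"
      by (intro derivative_eq_intros | simp)+
    moreover have "(g has_vector_derivative vector_derivative g (at t)) (at ((b - a) * ((t - a) / (b - a)) + a))"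
      using S[OF t] unfolding e by (simp add: vector_derivative_works)
    ultimately have "(g \<circ> (\<lambda>x. (b - a) * x + a) has_vector_derivative (b - a) *\<^sub>R vector_derivative g (at t)) (at ((t - a) / (b - a)))"
      by (rule vector_diff_chain_at)
    then show ?thesis by (intro vector_derivative_at) (simp add: subpath_def o_def)
  qed
  have "((\<lambda>x. f (?h x) * vector_derivative ?h (at x)) has_integral contour_integral ?h f) (cbox 0 1)"
    using has_contour_integral_integral[OF f] by (simp add: has_contour_integral)
  from has_integral_affinity[OF this, of "1 / (b - a)" "- a / (b - a)"] ab
  have "((\<lambda>t. f (?h ((t - a) / (b - a))) * vector_derivative ?h (at ((t - a) / (b - a)))) has_integral
      (b - a) *\<^sub>R contour_integral ?h f) {a..b}"
    by (simp add: image_affinity_atLeastAtMost divide_simps diff_divide_distrib[symmetric])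
  from has_integral_cmul[OF this, of "1 / (b - a)"] ab
  have "((\<lambda>t. (1 / (b - a)) *\<^sub>R (f (?h ((t - a) / (b - a))) * vector_derivative ?h (at ((t - a) / (b - a))))) has_integral
      contour_integral ?h f) {a..b}" by simp
  then have "((\<lambda>t. f (g t) * vector_derivative g (at t)) has_integral contour_integral ?h f) {a..b}"
  proof (rule has_integral_spike_finite[OF fs, rotated])
    fix t assume t: "t \<in> {a..b} - S"
    have "?h ((t - a) / (b - a)) = g t" using ab by (simp add: subpath_def)
    then show "f (g t) * vector_derivative g (at t) =
        (1 / (b - a)) *\<^sub>R (f (?h ((t - a) / (b - a))) * vector_derivative ?h (at ((t - a) / (b - a))))"
      using ab by (simp add: vd[OF t])
  qed
  then show ?thesis by (rule integral_unique)
qed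

section \<open>Closing a truncated contour through a vertical line\<close>

text \<open>Used with \<open>z\<close> the upper and \<open>w\<close> the lower end of the truncated
  contour: the vertical leg carries the line integral, backwards, and the two horizontal legs carry
  the error.\<close>

definition closing_path :: "real \<Rightarrow> complex \<Rightarrow> complex \<Rightarrow> real \<Rightarrow> complex" where
  "closing_path R z w = linepath z (Complex R (Im z)) +++
     (linepath (Complex R (Im z)) (Complex R (Im w)) +++ linepath (Complex R (Im w)) w)"

lemma closing_path_simps [simp]:
  "valid_path (closing_path R z w)" "path (closing_path R z w)"
  "pathstart (closing_path R z w) = z" "pathfinish (closing_path R z w) = w"
  by (auto simp: closing_path_def intro!: valid_path_join)

lemma path_image_closing_path:
  "path_image (closing_path R z w) = closed_segment z (Complex R (Im z)) \<union>
     closed_segment (Complex R (Im z)) (Complex R (Im w)) \<union> closed_segment (Complex R (Im w)) w"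
  by (simp add: closing_path_def path_image_join Un_assoc)

lemma closed_segment_Im_const:
  "u \<in> closed_segment z w \<Longrightarrow> Im z = Im w \<Longrightarrow> Im u = Im w"
  by (auto simp: in_segment left_diff_distrib)

lemma closed_segment_Re_const:
  "u \<in> closed_segment z w \<Longrightarrow> Re z = Re w \<Longrightarrow> Re u = Re w"
  by (auto simp: in_segment left_diff_distrib)

lemma closing_path_cases:
  assumes "u \<in> path_image (closing_path R z w)"
  shows "Im u = Im z \<or> Im u = Im w \<or> Re u = R"
  using assms closed_segment_Im_const closed_segment_Re_const
  unfolding path_image_closing_path by fastforce

lemma closing_path_subset_convex:
  assumes "convex S" "z \<in> S" "w \<in> S" "Complex R (Im z) \<in> S" "Complex R (Im w) \<in> S"
  shows "path_image (closing_path R z w) \<subseteq> S"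
  using assms unfolding path_image_closing_path by (auto dest: closed_segment_subset)

text \<open>The sign \<open>\<epsilon>\<close> treats poles left (\<open>\<epsilon> = 1\<close>) and right (\<open>\<epsilon> = - 1\<close>) of the contour at once. The
  closing path avoids the ray from \<open>p\<close> on which \<open>Ln (\<epsilon> (u - p))\<close> is discontinuous, so its winding
  number does not depend on \<open>R\<close>.\<close>

lemma winding_number_closing_path:
  assumes \<epsilon>: "\<epsilon> \<in> {1, -1::real}" and R: "\<epsilon> * (R - Re p) > 0"
    and Im: "Im w < Im p" "Im p < Im z"
  shows "p \<notin> path_image (closing_path R z w)"
    and "winding_number (closing_path R z w) p =
      1 / (2 * of_real pi * \<i>) * (Ln (of_real \<epsilon> * (w - p)) - Ln (of_real \<epsilon> * (z - p)))"
proof -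
  \<comment> \<open>The plane slit along the ray from \<open>p\<close> opposite to the direction
    \<open>\<epsilon>\<close>; on it the logarithm is a primitive of 1 / (u - p) for either
    sign.\<close>
  define S where "S = {u. of_real \<epsilon> * (u - p) \<notin> \<real>\<^sub>\<le>\<^sub>0}"
  have sub: "path_image (closing_path R z w) \<subseteq> S"
  proof
    fix u assume "u \<in> path_image (closing_path R z w)"
    from closing_path_cases[OF this] have "Im u \<noteq> Im p \<or> \<epsilon> * (Re u - Re p) > 0"
      using Im R by auto
    then show "u \<in> S" using \<epsilon> by (auto simp: S_def complex_nonpos_Reals_iff)
  qed
  then show np: "p \<notin> path_image (closing_path R z w)" by (auto simp: S_def)
  have d: "((\<lambda>u. Ln (of_real \<epsilon> * (u - p))) has_field_derivative 1 / (u - p)) (at u within S)"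
    if "u \<in> S" for u
  proof -
    have "of_real \<epsilon> * (u - p) \<notin> \<real>\<^sub>\<le>\<^sub>0" using that by (simp add: S_def)
    moreover have "u \<noteq> p" using that by (auto simp: S_def)
    ultimately show ?thesis using \<epsilon>
      by (auto intro!: derivative_eq_intros simp: field_simps)
  qed
  have "((\<lambda>u. 1 / (u - p)) has_contour_integral (Ln (of_real \<epsilon> * (w - p)) - Ln (of_real \<epsilon> * (z - p)))) (closing_path R z w)"
    using contour_integral_primitive[of S "\<lambda>u. Ln (of_real \<epsilon> * (u - p))" "\<lambda>u. 1 / (u - p)" "closing_path R z w"] d sub
    by simp
  then show "winding_number (closing_path R z w) p =
      1 / (2 * of_real pi * \<i>) * (Ln (of_real \<epsilon> * (w - p)) - Ln (of_real \<epsilon> * (z - p)))"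
    using winding_number_valid_path[OF _ np] by (simp add: contour_integral_unique)
qed

definition closed_loop :: "(real \<Rightarrow> complex) \<Rightarrow> real \<Rightarrow> real \<Rightarrow> real \<Rightarrow> real \<Rightarrow> complex" where
  "closed_loop g a b R = subpath a b g +++ closing_path R (g b) (g a)"

lemma closed_loop_simps:
  assumes "vertical_contour \<gamma> g" "a < b"
  shows "valid_path (closed_loop g a b R)" "path (closed_loop g a b R)"
    "pathfinish (closed_loop g a b R) = pathstart (closed_loop g a b R)"
    "path_image (closed_loop g a b R) = g ` {a..b} \<union> path_image (closing_path R (g b) (g a))"
proof -
  show v: "valid_path (closed_loop g a b R)"
    using valid_path_arc[OF assms] unfolding closed_loop_def by (intro valid_path_join) auto
  then show "path (closed_loop g a b R)" by (rule valid_path_imp_path)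
  show "pathfinish (closed_loop g a b R) = pathstart (closed_loop g a b R)"
    by (simp add: closed_loop_def)
  show "path_image (closed_loop g a b R) = g ` {a..b} \<union> path_image (closing_path R (g b) (g a))"
    using assms(2) unfolding closed_loop_def by (subst path_image_join) (auto simp: path_image_subpath)
qed

text \<open>Both vertical lines lie on the same side of \<open>p\<close>, so one branch of the
  logarithm serves both closing paths, and its increment depends on the end points only.\<close>

lemma winding_number_closed_loop_cong:
  assumes vc: "vertical_contour \<gamma> g" and ab: "a < b" and p: "p \<notin> range g" and \<epsilon>: "\<epsilon> \<in> {1, -1::real}"
    and "\<epsilon> * (R - Re p) > 0" "\<epsilon> * (R' - Re p) > 0" and Im: "Im (g a) < Im p" "Im p < Im (g b)"
  shows "winding_number (closed_loop g a b R) p = winding_number (closed_loop g a b R') p"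
proof -
  have "winding_number (closed_loop g a b R) p = winding_number (subpath a b g) p +
      1 / (2 * of_real pi * \<i>) * (Ln (of_real \<epsilon> * (g a - p)) - Ln (of_real \<epsilon> * (g b - p)))"
    if R: "\<epsilon> * (R - Re p) > 0" for R
  proof -
    note c = winding_number_closing_path[OF \<epsilon> R Im]
    have "p \<notin> path_image (subpath a b g)" using p ab by (auto simp: path_image_subpath)
    then show ?thesis
      unfolding closed_loop_def using valid_path_imp_path[OF valid_path_arc[OF vc ab]] c
      by (subst winding_number_join) auto
  qed
  then show ?thesis using assms by simp
qed

text \<open>Moving the closing line far away lets the loop avoid a path from \<open>p\<close> to \<open>x\<close>, and \<open>x\<close> lies outside
  a half-plane containing the loop.\<close>

lemma winding_number_closed_loop_eventually_0:
  assumes vc: "vertical_contour \<gamma> g" and \<epsilon>: "\<epsilon> \<in> {1, -1::real}"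
    and conn: "connected_component (- range g) p x"
    and x: "\<And>t. \<epsilon> * (Re (g t) - Re x) > 0" and R: "\<epsilon> * (R - Re p) > 0"
  shows "\<forall>\<^sub>F (a, b) in at_bot \<times>\<^sub>F at_top. winding_number (closed_loop g a b R) p = 0"
proof -
  have op: "open (- range g)" using vertical_contour_closed_range[OF vc] by blast
  then have "path_component (- range g) p x"
    using conn open_path_connected_component[OF op, of p] by simp
  then obtain h where h: "path h" "path_image h \<subseteq> - range g" "pathstart h = p" "pathfinish h = x"
    by (auto simp: path_component_def)
  have pin: "p \<in> path_image h" "x \<in> path_image h"
    using h pathstart_in_path_image pathfinish_in_path_image by auto
  obtain D where D: "\<And>u. u \<in> path_image h \<Longrightarrow> norm u \<le> D"
    using bounded_path_image[OF h(1)] by (auto simp: bounded_iff)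
  have D': "\<bar>Re u\<bar> \<le> D" "\<bar>Im u\<bar> \<le> D" if "u \<in> path_image h" for u
    using D[OF that] abs_Re_le_cmod[of u] abs_Im_le_cmod[of u] by auto
  \<comment> \<open>The new line lies beyond the disc of radius \<open>D\<close> around 0 that
    contains \<open>h\<close>, on the side \<open>\<epsilon>\<close> where the old line lies
    relative to \<open>p\<close>. For ends at heights beyond \<open>D\<close>, no part of the
    closing path meets \<open>h\<close>.\<close>
  define R' where "R' = \<epsilon> * (D + 1)"
  have R'gt: "\<epsilon> * (R' - Re u) > 0" if "u \<in> path_image h" for u
    using D'[OF that] \<epsilon> by (auto simp: R'_def)
  have main: "winding_number (closed_loop g a b R) p = 0"
    if ab: "a < b" and Im: "Im (g a) < - D" "D < Im (g b)" for a b
  proof -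
    note cl = closed_loop_simps[OF vc ab]
    have "path_image h \<inter> path_image (closed_loop g a b R') = {}"
    proof (rule ccontr)
      assume "path_image h \<inter> path_image (closed_loop g a b R') \<noteq> {}"
      then obtain u where u: "u \<in> path_image h" "u \<in> path_image (closed_loop g a b R')" by auto
      then have "u \<in> path_image (closing_path R' (g b) (g a))"
        using h(2) unfolding cl(4) by auto
      from closing_path_cases[OF this] show False
        using D'[OF u(1)] R'gt[OF u(1)] Im by auto
    qed
    then have "winding_number (closed_loop g a b R') p = winding_number (closed_loop g a b R') x"
      using cl pin h by (intro winding_number_eq[of _ p "path_image h"]) (auto intro: connected_path_image)
    also have "\<dots> = 0"
    proof (rule winding_number_zero_outside[of _ "{u. \<epsilon> * (Re u - Re x) > 0}"])
      have "{u. \<epsilon> * (Re u - Re x) > 0} = {u. complex_of_real \<epsilon> \<bullet> u > \<epsilon> * Re x}"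
        by (auto simp: inner_complex_def algebra_simps)
      then show cv: "convex {u. \<epsilon> * (Re u - Re x) > 0}" by (simp add: convex_halfspace_gt)
      show "path_image (closed_loop g a b R') \<subseteq> {u. \<epsilon> * (Re u - Re x) > 0}"
        unfolding cl(4) using x R'gt[OF pin(2)] by (intro Un_least closing_path_subset_convex[OF cv]) auto
    qed (use cl in auto)
    finally have "winding_number (closed_loop g a b R') p = 0" .
    moreover have "winding_number (closed_loop g a b R) p = winding_number (closed_loop g a b R') p"
      by (rule winding_number_closed_loop_cong[OF vc ab _ \<epsilon> R R'gt[OF pin(1)]])
         (use h pin D'[OF pin(1)] Im in auto)
    ultimately show ?thesis by simp
  qed
  have "\<forall>\<^sub>F a in at_bot. Im (g a) < - D \<and> a < 0" "\<forall>\<^sub>F b in at_top. D < Im (g b) \<and> 0 < b"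
    using vc by (auto simp: vertical_contour_def filterlim_at_top_dense filterlim_at_bot_dense
        eventually_conj_iff eventually_gt_at_top eventually_gt_at_bot)
  from eventually_prodI[OF this] show ?thesis
    by eventually_elim (use main in auto)
qed

text \<open>The vertical leg is run downwards with ds = i dy, which gives the middle term its sign
  and its factor.\<close>

lemma contour_integral_closing_path:
  assumes f: "continuous_on (path_image (closing_path R z w)) f" and Im: "Im w < Im z"
  shows "contour_integral (closing_path R z w) f = contour_integral (linepath z (Complex R (Im z))) f
     - \<i> * integral {Im w..Im z} (\<lambda>y. f (Complex R y)) + contour_integral (linepath (Complex R (Im w)) w) f"
    and "f contour_integrable_on (closing_path R z w)"
    and "f contour_integrable_on linepath z (Complex R (Im z))"
    and "f contour_integrable_on linepath (Complex R (Im w)) w"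
proof -
  let ?a = "Complex R (Im z)" and ?b = "Complex R (Im w)"
  have c: "continuous_on (closed_segment z ?a) f" "continuous_on (closed_segment ?a ?b) f"
    "continuous_on (closed_segment ?b w) f"
    using f by (auto elim!: continuous_on_subset simp: path_image_closing_path)
  note i = c[THEN contour_integrable_continuous_linepath]
  show "f contour_integrable_on (closing_path R z w)"
    unfolding closing_path_def using i by simp
  show "f contour_integrable_on linepath z (Complex R (Im z))"
    "f contour_integrable_on linepath (Complex R (Im w)) w" by (rule i)+
  have "contour_integral (linepath ?b ?a) f = \<i> * integral {Im w..Im z} (\<lambda>y. f (Complex R y))"
    by (rule contour_integral_linepath_same_Re) (use Im in auto)
  moreover have "contour_integral (linepath ?a ?b) f = - contour_integral (linepath ?b ?a) f"
    using contour_integral_reverse_linepath[OF c(2)] by simp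
  ultimately show "contour_integral (closing_path R z w) f = contour_integral (linepath z (Complex R (Im z))) f
     - \<i> * integral {Im w..Im z} (\<lambda>y. f (Complex R y)) + contour_integral (linepath (Complex R (Im w)) w) f"
    unfolding closing_path_def using i by simp
qed

text \<open>For each pole the winding number vanishes only eventually, and only finitely many such
  conditions can be combined; hence the finiteness of \<open>P\<close> in strips. Poles outside the
  strip containing the loop have winding number 0 by convexity. Poles being real, the horizontal
  legs avoid them once both ends are at heights beyond 1.\<close>

theorem contour_integral_shift_to_line:
  assumes vc: "vertical_contour \<gamma> g"
    and P: "closed P" "f holomorphic_on - P" "\<And>M. finite {p\<in>P. \<bar>Re p\<bar> \<le> M}"
    and sep: "\<And>p. p \<in> P \<Longrightarrow> Re p < R \<and> p \<in> left_of_contour g \<or> Re p > R \<and> p \<in> right_of_contour g"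
    and decay: "\<And>A B. \<exists>C. \<forall>s. A \<le> Re s \<longrightarrow> Re s \<le> B \<longrightarrow> \<bar>Im s\<bar> \<ge> 1 \<longrightarrow> norm (f s) * (Im s)\<^sup>2 \<le> C"
    and lim: "((\<lambda>(u, v). integral {u..v} (\<lambda>y. f (Complex R y))) \<longlongrightarrow> L) (at_bot \<times>\<^sub>F at_top)"
    and PIm: "\<And>p. p \<in> P \<Longrightarrow> Im p = 0"
  shows "has_improper_contour_integral f (\<i> * L) g"
proof -
  obtain M0 where M0: "\<And>t. \<bar>Re (g t)\<bar> \<le> M0" by (rule vertical_contour_Re_bounded[OF vc]) auto
  \<comment> \<open>The strip of half-width \<open>M\<close> holds the contour and the line, hence
    the whole closed loop.\<close>
  define M where "M = max M0 \<bar>R\<bar>"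
  have M: "\<bar>Re (g t)\<bar> \<le> M" "\<bar>R\<bar> \<le> M" for t using M0[of t] by (auto simp: M_def)
  obtain C0 where C0: "\<And>s. - M \<le> Re s \<Longrightarrow> Re s \<le> M \<Longrightarrow> \<bar>Im s\<bar> \<ge> 1 \<Longrightarrow> norm (f s) * (Im s)\<^sup>2 \<le> C0"
    using decay[of "- M" M] by blast
  define C where "C = max C0 0"
  have C: "C \<ge> 0" "\<And>s. \<bar>Re s\<bar> \<le> M \<Longrightarrow> \<bar>Im s\<bar> \<ge> 1 \<Longrightarrow> norm (f s) \<le> C / (Im s)\<^sup>2"
  proof -
    fix s :: complex assume s: "\<bar>Re s\<bar> \<le> M" "\<bar>Im s\<bar> \<ge> 1"
    then have "Im s \<noteq> 0" by auto
    then have "(Im s)\<^sup>2 > 0" by simp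
    moreover have "norm (f s) * (Im s)\<^sup>2 \<le> C" using C0[of s] s by (simp add: C_def abs_le_iff le_max_iff_disj)
    ultimately show "norm (f s) \<le> C / (Im s)\<^sup>2" by (simp add: pos_le_divide_eq)
  qed (simp add: C_def)
  have notP: "p \<notin> range g" if "p \<in> P" for p
    using sep[OF that] connected_component_in by (fastforce simp: left_of_contour_def right_of_contour_def)
  have wind1: "\<forall>\<^sub>F (a, b) in at_bot \<times>\<^sub>F at_top. winding_number (closed_loop g a b R) p = 0" if p: "p \<in> P" for p
    using sep[OF p]
  proof (elim disjE conjE)
    assume "Re p < R" "p \<in> left_of_contour g"
    then show ?thesis
      by (auto simp: left_of_contour_def intro!: winding_number_closed_loop_eventually_0[OF vc, of 1])
  next
    assume "Re p > R" "p \<in> right_of_contour g"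
    then show ?thesis
      by (auto simp: right_of_contour_def intro!: winding_number_closed_loop_eventually_0[OF vc, of "-1"])
  qed
  have ev1: "\<forall>\<^sub>F ab in at_bot \<times>\<^sub>F at_top. \<forall>p\<in>{p\<in>P. \<bar>Re p\<bar> \<le> M}. winding_number (closed_loop g (fst ab) (snd ab) R) p = 0"
    using wind1[unfolded case_prod_unfold] P(3)[of M] by (intro eventually_ball_finite) auto
  have "\<forall>\<^sub>F a in at_bot. Im (g a) < - 1 \<and> a < 0" "\<forall>\<^sub>F b in at_top. 1 < Im (g b) \<and> 0 < b"
    using vc by (auto simp: vertical_contour_def filterlim_at_top_dense filterlim_at_bot_dense
        eventually_conj_iff eventually_gt_at_top eventually_gt_at_bot)
  note ev2 = eventually_prodI[OF this]
  \<comment> \<open>Compares the truncated contour with the line between the heights of its end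
    points. By Cauchy's theorem \<open>E\<close> is minus the integral over the two horizontal legs,
    each of length at most 2 M and with integrand at most \<open>C / (Im s)\<^sup>2\<close>.\<close>
  define E where "E = (\<lambda>ab. integral {fst ab..snd ab} (\<lambda>t. f (g t) * vector_derivative g (at t)) -
      \<i> * integral {Im (g (fst ab))..Im (g (snd ab))} (\<lambda>y. f (Complex R y)))"
  have Ebound: "norm (E ab) \<le> 2 * M * C * (1 / (Im (g (fst ab)))\<^sup>2 + 1 / (Im (g (snd ab)))\<^sup>2)"
    if w: "\<forall>p\<in>{p\<in>P. \<bar>Re p\<bar> \<le> M}. winding_number (closed_loop g (fst ab) (snd ab) R) p = 0"
      and ab': "(Im (g (fst ab)) < - 1 \<and> fst ab < 0) \<and> 1 < Im (g (snd ab)) \<and> 0 < snd ab" for ab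
  proof -
    define a b where "a = fst ab" and "b = snd ab"
    have ab: "a < b" "Im (g a) < -1" "1 < Im (g b)" using ab' by (auto simp: a_def b_def)
    note cl = closed_loop_simps[OF vc ab(1)]
    let ?S = "{u. \<bar>Re u\<bar> \<le> M}"
    have cv: "convex ?S"
    proof -
      have "?S = {u. Re u \<le> M} \<inter> {u. Re u \<ge> - M}" by auto
      then show ?thesis by (simp add: convex_Int convex_halfspace_Re_le convex_halfspace_Re_ge)
    qed
    have sub: "path_image (closing_path R (g b) (g a)) \<subseteq> ?S"
      using M by (intro closing_path_subset_convex[OF cv]) auto
    have avoid: "path_image (closing_path R (g b) (g a)) \<subseteq> - P"
    proof
      fix u assume "u \<in> path_image (closing_path R (g b) (g a))"
      from closing_path_cases[OF this] show "u \<in> - P"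
        using PIm[of u] sep[of u] ab by auto
    qed
    have fcont: "continuous_on (path_image (closing_path R (g b) (g a))) f"
      using holomorphic_on_imp_continuous_on[OF P(2)] avoid by (rule continuous_on_subset)
    have Imab: "Im (g a) < Im (g b)" using ab by simp
    note cp = contour_integral_closing_path[OF fcont Imab]
    have "(f has_contour_integral 0) (closed_loop g a b R)"
    proof (rule Cauchy_theorem_global[OF _ P(2) cl(1,3)])
      show "open (- P)" using P(1) by blast
      show "path_image (closed_loop g a b R) \<subseteq> - P"
        unfolding cl(4) using avoid notP by auto
      fix p assume "p \<notin> - P"
      then have p: "p \<in> P" by simp
      show "winding_number (closed_loop g a b R) p = 0"
      proof (cases "\<bar>Re p\<bar> \<le> M")
        case True
        then show ?thesis using w p by (auto simp: a_def b_def)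
      next
        case False
        show ?thesis
          by (rule winding_number_zero_outside[OF cl(2) cv cl(3)])
             (use False sub M in \<open>auto simp: cl(4)\<close>)
      qed
    qed
    then have "f contour_integrable_on (closed_loop g a b R)" "contour_integral (closed_loop g a b R) f = 0"
      by (auto simp: contour_integral_unique has_contour_integral_integrable)
    then have fi: "f contour_integrable_on (subpath a b g)"
      and sum0: "contour_integral (subpath a b g) f + contour_integral (closing_path R (g b) (g a)) f = 0"
      using valid_path_arc[OF vc ab(1)] cp(2) unfolding closed_loop_def by (auto simp: eq_neg_iff_add_eq_0)
    have h: "norm (contour_integral (linepath z w) f) \<le> C / (Im z)\<^sup>2 * (2 * M)"
      if "Im z = Im w" "\<bar>Im z\<bar> \<ge> 1" "\<bar>Re z\<bar> \<le> M" "\<bar>Re w\<bar> \<le> M" "f contour_integrable_on linepath z w" for z w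
    proof -
      have "norm (contour_integral (linepath z w) f) \<le> C / (Im z)\<^sup>2 * norm (w - z)"
      proof (rule contour_integral_bound_linepath[OF that(5)])
        fix u assume u: "u \<in> closed_segment z w"
        have "u \<in> ?S" using closed_segment_subset[OF _ _ cv] u that by blast
        moreover have "Im u = Im z" using closed_segment_Im_const[OF u that(1)] that(1) by simp
        ultimately show "norm (f u) \<le> C / (Im z)\<^sup>2" using C(2)[of u] that by simp
      qed (use C in auto)
      also have "norm (w - z) = \<bar>Re w - Re z\<bar>" using that by (simp add: cmod_def)
      also have "C / (Im z)\<^sup>2 * \<bar>Re w - Re z\<bar> \<le> C / (Im z)\<^sup>2 * (2 * M)"
        using C that by (intro mult_left_mono) auto
      finally show ?thesis .
    qed
    have "E ab = contour_integral (subpath a b g) f - \<i> * integral {Im (g a)..Im (g b)} (\<lambda>y. f (Complex R y))"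
      using integral_arc[OF vc ab(1) fi] by (simp add: E_def a_def b_def)
    also have "\<dots> = - (contour_integral (linepath (g b) (Complex R (Im (g b)))) f +
        contour_integral (linepath (Complex R (Im (g a))) (g a)) f)"
      using sum0 cp(1) by (simp add: algebra_simps add_eq_0_iff)
    also have "norm \<dots> \<le> C / (Im (g b))\<^sup>2 * (2 * M) + C / (Im (g a))\<^sup>2 * (2 * M)"
      unfolding norm_minus_cancel
      using h[of "g b" "Complex R (Im (g b))"] h[of "Complex R (Im (g a))" "g a"] cp(3,4) M ab
      by (intro norm_triangle_mono) auto
    also have "\<dots> = 2 * M * C * (1 / (Im (g a))\<^sup>2 + 1 / (Im (g b))\<^sup>2)"
      by (simp add: algebra_simps)
    finally show ?thesis by (simp add: a_def b_def)
  qed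
  have fl: "filterlim (\<lambda>ab. Im (g (fst ab))) at_bot (at_bot \<times>\<^sub>F at_top)"
    "filterlim (\<lambda>ab. Im (g (snd ab))) at_top (at_bot \<times>\<^sub>F at_top)"
    using vc by (auto simp: vertical_contour_def intro: filterlim_compose[OF _ filterlim_fst] filterlim_compose[OF _ filterlim_snd])
  have inf: "filterlim (\<lambda>ab. (Im (g (fst ab)))\<^sup>2) at_infinity (at_bot \<times>\<^sub>F at_top)"
    "filterlim (\<lambda>ab. (Im (g (snd ab)))\<^sup>2) at_infinity (at_bot \<times>\<^sub>F at_top)"
    by (rule filterlim_compose[OF filterlim_power_at_infinity filterlim_mono[OF fl(1) at_bot_le_at_infinity order_refl]], simp,
        rule filterlim_compose[OF filterlim_power_at_infinity filterlim_mono[OF fl(2) at_top_le_at_infinity order_refl]], simp)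
  have "(E \<longlongrightarrow> 0) (at_bot \<times>\<^sub>F at_top)"
  proof (rule Lim_null_comparison)
    show "\<forall>\<^sub>F ab in at_bot \<times>\<^sub>F at_top. norm (E ab) \<le> 2 * M * C * (1 / (Im (g (fst ab)))\<^sup>2 + 1 / (Im (g (snd ab)))\<^sup>2)"
      using ev1 ev2 by eventually_elim (rule Ebound)
    have "((\<lambda>ab. 2 * M * C * (1 / (Im (g (fst ab)))\<^sup>2 + 1 / (Im (g (snd ab)))\<^sup>2)) \<longlongrightarrow> 2 * M * C * (0 + 0)) (at_bot \<times>\<^sub>F at_top)"
      by (intro tendsto_intros tendsto_divide_0[OF tendsto_const] inf)
    then show "((\<lambda>ab. 2 * M * C * (1 / (Im (g (fst ab)))\<^sup>2 + 1 / (Im (g (snd ab)))\<^sup>2)) \<longlongrightarrow> 0) (at_bot \<times>\<^sub>F at_top)"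
      by simp
  qed
  \<comment> \<open>The limit along the line is taken at the heights of the moving ends, which tend
    to the two infinities independently.\<close>
  moreover have "((\<lambda>ab. integral {Im (g (fst ab))..Im (g (snd ab))} (\<lambda>y. f (Complex R y))) \<longlongrightarrow> L) (at_bot \<times>\<^sub>F at_top)"
    using filterlim_compose[OF lim filterlim_Pair[OF fl]] by simp
  ultimately have "((\<lambda>ab. E ab + \<i> * integral {Im (g (fst ab))..Im (g (snd ab))} (\<lambda>y. f (Complex R y))) \<longlongrightarrow> 0 + \<i> * L) (at_bot \<times>\<^sub>F at_top)"
    by (intro tendsto_intros)
  then show ?thesis
    by (simp add: has_improper_contour_integral_def E_def case_prod_unfold)
qed

text \<open>To let the ends move independently, the interval is written as two half-lines: the
  integral up to \<open>v\<close> plus the one from \<open>u\<close> on minus the full integral.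
  Reflection turns the lower end into a limit at +infinity.\<close>

lemma integral_Icc_tendsto_lborel:
  fixes h :: "real \<Rightarrow> complex"
  assumes h: "integrable lborel h"
  shows "((\<lambda>(u, v). integral {u..v} h) \<longlongrightarrow> integral\<^sup>L lborel h) (at_bot \<times>\<^sub>F at_top)"
proof -
  define A where "A = (\<lambda>v. LINT x|lborel. indicator {..v} x *\<^sub>R h x)"
  define B where "B = (\<lambda>w. LINT x|lborel. indicator {..w} x *\<^sub>R h (- x))"
  have h': "integrable lborel (\<lambda>x. h (- x))"
    using lborel_integrable_real_affine[OF h, of "-1" 0] by simp
  have ih': "(LINT x|lborel. h (- x)) = integral\<^sup>L lborel h"
    using lborel_integral_real_affine[of "-1" h 0] by simp
  have A: "(A \<longlongrightarrow> integral\<^sup>L lborel h) at_top"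
    unfolding A_def by (rule tendsto_integral_at_top[OF _ h]) simp
  have B: "(B \<longlongrightarrow> integral\<^sup>L lborel h) at_top"
    unfolding B_def ih'[symmetric] by (rule tendsto_integral_at_top[OF _ h']) simp
  have Aab: "((\<lambda>ab. A (snd ab)) \<longlongrightarrow> integral\<^sup>L lborel h) (at_bot \<times>\<^sub>F at_top)"
    by (rule filterlim_compose[OF A filterlim_snd])
  have Bab: "((\<lambda>ab. B (- fst ab)) \<longlongrightarrow> integral\<^sup>L lborel h) (at_bot \<times>\<^sub>F at_top)"
    by (rule filterlim_compose[OF B filterlim_compose[OF filterlim_uminus_at_top_at_bot filterlim_fst]])
  have eq: "integral {u..v} h = A v + B (- u) - integral\<^sup>L lborel h" if uv: "u \<le> v" for u v
  proof -
    have ii: "integrable lborel (\<lambda>x. indicator S x *\<^sub>R h x)" if "S \<in> sets borel" for S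
      using integrable_mult_indicator[OF _ h, of S] that by simp
    have "B (- u) = (LINT x|lborel. indicator {..- u} (- x) *\<^sub>R h x)"
      unfolding B_def
      using lborel_integral_real_affine[of "-1" "\<lambda>x. indicator {..- u} (- x) *\<^sub>R h x" 0] by simp
    also have "\<dots> = (LINT x|lborel. indicator {u..} x *\<^sub>R h x)"
      by (intro Bochner_Integration.integral_cong) (auto simp: indicator_def)
    finally have Bu: "B (- u) = (LINT x|lborel. indicator {u..} x *\<^sub>R h x)" .
    have "A v + B (- u) - integral\<^sup>L lborel h =
        (LINT x|lborel. indicator {..v} x *\<^sub>R h x + indicator {u..} x *\<^sub>R h x - h x)"
      unfolding A_def Bu using ii h by simp
    also have "\<dots> = (LINT x|lborel. indicator {u..v} x *\<^sub>R h x)"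
      using uv by (intro Bochner_Integration.integral_cong) (auto simp: indicator_def)
    also have "\<dots> = integral {u..v} h"
      using set_borel_integral_eq_integral(2)[of "{u..v}" h] ii[of "{u..v}"]
      by (simp add: set_integrable_def set_lebesgue_integral_def)
    finally show ?thesis by simp
  qed
  have "\<forall>\<^sub>F u in at_bot. u \<le> (0::real)" "\<forall>\<^sub>F v in at_top. (0::real) \<le> v"
    by (auto simp: eventually_le_at_bot eventually_ge_at_top)
  from eventually_prodI[OF this]
  have ev: "\<forall>\<^sub>F ab in at_bot \<times>\<^sub>F at_top. A (snd ab) + B (- fst ab) - integral\<^sup>L lborel h = integral {fst ab..snd ab} h"
    by eventually_elim (simp add: eq)
  have "((\<lambda>ab. A (snd ab) + B (- fst ab) - integral\<^sup>L lborel h) \<longlongrightarrow>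
      integral\<^sup>L lborel h + integral\<^sup>L lborel h - integral\<^sup>L lborel h) (at_bot \<times>\<^sub>F at_top)"
    by (intro tendsto_intros Aab Bab)
  then have "((\<lambda>ab. A (snd ab) + B (- fst ab) - integral\<^sup>L lborel h) \<longlongrightarrow> integral\<^sup>L lborel h) (at_bot \<times>\<^sub>F at_top)"
    by simp
  from Lim_transform_eventually[OF this ev] show ?thesis
    by (simp add: case_prod_unfold)
qed

subsection \<open>Positivity of the \<open>G\<close>-function\<close>

text \<open>All parameters are real, and \<open>\<rho>s\<close> and \<open>ws\<close> list \<open>1 - \<alpha>\<^sub>j\<close> for \<open>j \<le> n\<close> and \<open>1 - \<beta>\<^sub>j\<close> for
  \<open>j > m\<close>. The poles to be right of the contour are then the negatives of \<open>left_poles \<rho>s\<close>.\<close>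

definition gamma_quotient ::
    "real list \<Rightarrow> real list \<Rightarrow> real list \<Rightarrow> real list \<Rightarrow> complex \<Rightarrow> complex" where
  "gamma_quotient \<beta>s \<rho>s ws ds s =
     (\<Prod>\<beta>\<leftarrow>\<beta>s. Gamma (of_real \<beta> + s)) * (\<Prod>\<rho>\<leftarrow>\<rho>s. Gamma (of_real \<rho> - s)) *
     (\<Prod>w\<leftarrow>ws. rGamma (of_real w - s)) * (\<Prod>d\<leftarrow>ds. rGamma (of_real d + s))"

lemma fox_Xi_real_parameters:
  "fox_Xi (length \<beta>s) (length \<rho>s)
     (map (\<lambda>\<alpha>. (\<alpha>, 1)) (map (\<lambda>\<rho>. complex_of_real (1 - \<rho>)) \<rho>s @ map complex_of_real ds))
     (map (\<lambda>\<beta>. (\<beta>, 1)) (map complex_of_real \<beta>s @ map (\<lambda>w. complex_of_real (1 - w)) ws)) =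
   gamma_quotient \<beta>s \<rho>s ws ds"
  by (rule ext) (simp add: fox_Xi_def gamma_quotient_def o_def)

lemma holomorphic_on_prod_list [holomorphic_intros]:
  "(\<And>x. x \<in> set xs \<Longrightarrow> f x holomorphic_on A) \<Longrightarrow> (\<lambda>s. \<Prod>x\<leftarrow>xs. f x s) holomorphic_on A"
  by (induction xs) (auto intro!: holomorphic_intros)

section \<open>Poles and admissible contours for real parameters\<close>

definition left_poles :: "real list \<Rightarrow> complex set" where
  "left_poles \<beta>s = {p. \<exists>\<beta>\<in>set \<beta>s. of_real \<beta> + p \<in> \<int>\<^sub>\<le>\<^sub>0}"

lemma closed_left_poles: "closed (left_poles \<beta>s)"
proof -
  have "left_poles \<beta>s = (\<Union>\<beta>\<in>set \<beta>s. (\<lambda>p. of_real \<beta> + p) -` \<int>\<^sub>\<le>\<^sub>0)"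
    by (auto simp: left_poles_def)
  then show ?thesis by (auto intro!: closed_UN closed_vimage continuous_intros)
qed

lemma left_poles_cases:
  assumes "p \<in> left_poles \<beta>s"
  obtains \<beta> n where "\<beta> \<in> set \<beta>s" "p = of_real (- \<beta> - real n)"
proof -
  obtain \<beta> n where "\<beta> \<in> set \<beta>s" "of_real \<beta> + p = - of_nat n"
    using assms by (auto simp: left_poles_def elim!: nonpos_Ints_cases')
  then show ?thesis by (intro that[of \<beta> n]) (auto simp: complex_eq_iff)
qed

lemma finite_left_poles_strip: "finite {p \<in> left_poles \<beta>s. \<bar>Re p\<bar> \<le> M}"
proof (rule finite_subset)
  define K where "K = (\<lambda>\<beta>. nat \<lceil>M + \<bar>\<beta>\<bar>\<rceil>)"
  show "{p \<in> left_poles \<beta>s. \<bar>Re p\<bar> \<le> M} \<subseteq> (\<Union>\<beta>\<in>set \<beta>s. (\<lambda>n. of_real (- \<beta> - real n)) ` {..K \<beta>})"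
  proof safe
    fix p assume p: "p \<in> left_poles \<beta>s" "\<bar>Re p\<bar> \<le> M"
    obtain \<beta> n where b: "\<beta> \<in> set \<beta>s" "p = of_real (- \<beta> - real n)" by (rule left_poles_cases[OF p(1)])
    then have "real n \<le> M + \<bar>\<beta>\<bar>" using p(2) by simp
    then have "n \<le> K \<beta>" unfolding K_def by linarith
    then show "p \<in> (\<Union>\<beta>\<in>set \<beta>s. (\<lambda>n. of_real (- \<beta> - real n)) ` {..K \<beta>})" using b by auto
  qed
qed auto

text \<open>A pole of \<open>Gamma\<close> pulls back along an injective affine map, and elsewhere
  the composite is holomorphic near \<open>p\<close>. The two signs cover both kinds of factors in
  \<open>fox_contour\<close>.\<close>

lemma is_pole_Gamma_affine_iff:
  assumes \<epsilon>: "\<epsilon> \<in> {1, -1::complex}"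
  shows "is_pole (\<lambda>s. Gamma (a + \<epsilon> * s)) p \<longleftrightarrow> a + \<epsilon> * p \<in> \<int>\<^sub>\<le>\<^sub>0"
proof
  assume "a + \<epsilon> * p \<in> \<int>\<^sub>\<le>\<^sub>0"
  then obtain n where "a + \<epsilon> * p = - of_nat n" by (elim nonpos_Ints_cases')
  then have "filterlim Gamma at_infinity (at (a + \<epsilon> * p))"
    using is_pole_Gamma[of n] by (simp add: is_pole_def)
  moreover have "filterlim (\<lambda>s. a + \<epsilon> * s) (at (a + \<epsilon> * p)) (at p)"
  proof (rule filterlim_atI)
    show "((\<lambda>s. a + \<epsilon> * s) \<longlongrightarrow> a + \<epsilon> * p) (at p)" by (intro tendsto_intros)
    show "\<forall>\<^sub>F s in at p. a + \<epsilon> * s \<noteq> a + \<epsilon> * p"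
      using \<epsilon> by (auto simp: eventually_at intro!: exI[of _ 1])
  qed
  ultimately show "is_pole (\<lambda>s. Gamma (a + \<epsilon> * s)) p"
    unfolding is_pole_def by (rule filterlim_compose)
next
  assume pole: "is_pole (\<lambda>s. Gamma (a + \<epsilon> * s)) p"
  show "a + \<epsilon> * p \<in> \<int>\<^sub>\<le>\<^sub>0"
  proof (rule ccontr)
    assume np: "a + \<epsilon> * p \<notin> \<int>\<^sub>\<le>\<^sub>0"
    have "open (- ((\<lambda>s. a + \<epsilon> * s) -` \<int>\<^sub>\<le>\<^sub>0))"
      by (intro open_Compl closed_vimage continuous_intros) auto
    then have "\<not> is_pole (\<lambda>s. Gamma (a + \<epsilon> * s)) p"
      by (rule not_is_pole_holomorphic) (use np in \<open>auto intro!: holomorphic_intros\<close>)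
    with pole show False by simp
  qed
qed

lemma fox_contour_real_parameters:
  "fox_contour (length \<beta>s) (length \<rho>s)
     (map (\<lambda>\<alpha>. (\<alpha>, 1)) (map (\<lambda>\<rho>. complex_of_real (1 - \<rho>)) \<rho>s @ map complex_of_real ds))
     (map (\<lambda>\<beta>. (\<beta>, 1)) (map complex_of_real \<beta>s @ map (\<lambda>w. complex_of_real (1 - w)) ws)) g \<longleftrightarrow>
   (\<exists>\<gamma>. vertical_contour \<gamma> g) \<and> left_poles \<beta>s \<subseteq> left_of_contour g \<and>
     uminus ` left_poles \<rho>s \<subseteq> right_of_contour g"
proof -
  have 1: "is_pole (\<lambda>s. Gamma (a + s)) p \<longleftrightarrow> a + p \<in> \<int>\<^sub>\<le>\<^sub>0"
      "is_pole (\<lambda>s. Gamma (a - s)) p \<longleftrightarrow> a - p \<in> \<int>\<^sub>\<le>\<^sub>0" for a p :: complex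
    using is_pole_Gamma_affine_iff[of 1] is_pole_Gamma_affine_iff[of "-1"] by simp_all
  have 2: "uminus ` left_poles \<rho>s = {p. \<exists>\<rho>\<in>set \<rho>s. of_real \<rho> - p \<in> \<int>\<^sub>\<le>\<^sub>0}"
    unfolding left_poles_def by (auto simp: image_iff) (metis diff_conv_add_uminus minus_minus)
  show ?thesis
    unfolding fox_contour_def 2 by (simp add: 1) (auto simp: left_poles_def)
qed

lemma vertical_contour_line: "vertical_contour R (\<lambda>t. Complex R t)"
proof -
  have eq: "(\<lambda>t. Complex R t) = (\<lambda>t. of_real R + \<i> * of_real t)" by (simp add: Complex_eq)
  have "(\<lambda>t. Complex R t) piecewise_C1_differentiable_on {a..b}" for a b
    unfolding eq
    by (intro C1_differentiable_imp_piecewise)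
       (auto simp: C1_differentiable_on_def intro!: exI[of _ "\<lambda>_. \<i>"] derivative_eq_intros
          has_vector_derivative_real_field)
  then show ?thesis
    by (auto simp: vertical_contour_def inj_def filterlim_ident)
qed

lemma left_of_line: "Re p < R \<Longrightarrow> p \<in> left_of_contour (\<lambda>t. Complex R t)"
  unfolding left_of_contour_def by (auto intro!: exI[of _ p])

lemma right_of_line: "R < Re p \<Longrightarrow> p \<in> right_of_contour (\<lambda>t. Complex R t)"
  unfolding right_of_contour_def by (auto intro!: exI[of _ p])

lemma norm_of_real_powr:
  assumes "t > 0"
  shows "norm (complex_of_real t powr s) = exp (Re s * ln t)"
  using assms by (simp add: powr_def Ln_of_real)

text \<open>The line is itself admissible and every admissible contour yields
  \<open>\<i> * L\<close>, so the definite description denotes that number; its \<open>\<i>\<close>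
  cancels against the prefactor.\<close>

theorem meijer_G_line_integral:
  fixes \<beta>s \<rho>s ws ds :: "real list"
  defines "Q \<equiv> gamma_quotient \<beta>s \<rho>s ws ds"
  assumes t: "t > 0" and \<beta>: "\<And>\<beta>. \<beta> \<in> set \<beta>s \<Longrightarrow> - \<beta> < R" and \<rho>: "\<And>\<rho>. \<rho> \<in> set \<rho>s \<Longrightarrow> R < \<rho>"
    and int: "integrable lborel (\<lambda>y. Q (Complex R y))"
    and decay: "strip_bounded (\<lambda>s. Q s * of_real ((Im s)\<^sup>2))"
  shows "meijer_G (length \<beta>s) (length \<rho>s)
      (map (\<lambda>\<rho>. complex_of_real (1 - \<rho>)) \<rho>s @ map complex_of_real ds)
      (map complex_of_real \<beta>s @ map (\<lambda>w. complex_of_real (1 - w)) ws) t =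
    (LINT y|lborel. Q (Complex R y) * complex_of_real t powr (- Complex R y)) / (2 * of_real pi)"
proof -
  define f where "f = (\<lambda>s. Q s * complex_of_real t powr (- s))"
  define L where "L = (LINT y|lborel. f (Complex R y))"
  define P where "P = left_poles \<beta>s \<union> uminus ` left_poles \<rho>s"
  define contour where "contour = (\<lambda>g. (\<exists>\<gamma>. vertical_contour \<gamma> g) \<and> left_poles \<beta>s \<subseteq> left_of_contour g \<and>
     uminus ` left_poles \<rho>s \<subseteq> right_of_contour g)"
  have Re_left: "Re p < R" if pl: "p \<in> left_poles \<beta>s" for p
  proof -
    obtain b n where "b \<in> set \<beta>s" "p = of_real (- b - real n)" by (rule left_poles_cases[OF pl])
    then show ?thesis using \<beta>[of b] by simp
  qed
  have Re_right: "Re p > R" if pr: "p \<in> uminus ` left_poles \<rho>s" for p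
  proof -
    obtain p' where p': "p' \<in> left_poles \<rho>s" "p = - p'" using pr by auto
    obtain r n where "r \<in> set \<rho>s" "p' = of_real (- r - real n)" by (rule left_poles_cases[OF p'(1)])
    then show ?thesis using \<rho>[of r] p'(2) by simp
  qed
  have closedP: "closed P"
    unfolding P_def by (intro closed_Un closed_left_poles closed_negations)
  have PIm: "Im p = 0" if "p \<in> P" for p
    using that by (auto simp: P_def elim!: left_poles_cases)
  have finP: "finite {p\<in>P. \<bar>Re p\<bar> \<le> M}" for M
  proof -
    have "{p\<in>P. \<bar>Re p\<bar> \<le> M} \<subseteq> {p \<in> left_poles \<beta>s. \<bar>Re p\<bar> \<le> M} \<union> uminus ` {p \<in> left_poles \<rho>s. \<bar>Re p\<bar> \<le> M}"
      by (auto simp: P_def)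
    then show ?thesis by (rule finite_subset) (auto intro: finite_left_poles_strip)
  qed
  have hol: "f holomorphic_on - P"
  proof -
    have "of_real r - s \<notin> \<int>\<^sub>\<le>\<^sub>0" if "s \<in> - P" "r \<in> set \<rho>s" for r s
    proof
      assume "of_real r - s \<in> \<int>\<^sub>\<le>\<^sub>0"
      then have "- s \<in> left_poles \<rho>s" using that(2) by (auto simp: left_poles_def)
      then have "s \<in> P" unfolding P_def by (metis UnI2 image_eqI minus_minus)
      with that(1) show False by simp
    qed
    then show ?thesis
      unfolding f_def Q_def gamma_quotient_def using t
      by (intro holomorphic_intros) (auto simp: P_def left_poles_def)
  qed
  have fdecay: "\<exists>C. \<forall>s. A \<le> Re s \<longrightarrow> Re s \<le> B \<longrightarrow> \<bar>Im s\<bar> \<ge> 1 \<longrightarrow> norm (f s) * (Im s)\<^sup>2 \<le> C" for A B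
  proof -
    obtain C where C: "C \<ge> 0" "\<And>s. A \<le> Re s \<Longrightarrow> Re s \<le> B \<Longrightarrow> \<bar>Im s\<bar> \<ge> 1 \<Longrightarrow>
        norm (Q s * of_real ((Im s)\<^sup>2)) \<le> C"
      using strip_boundedD[OF decay] by blast
    \<comment> \<open>On the strip the real part is at most max \<bar>A\<bar> \<bar>B\<bar> in
      modulus, so the power of \<open>t\<close> costs only a constant.\<close>
    have "norm (f s) * (Im s)\<^sup>2 \<le> C * exp (max \<bar>A\<bar> \<bar>B\<bar> * \<bar>ln t\<bar>)"
      if s: "A \<le> Re s" "Re s \<le> B" "\<bar>Im s\<bar> \<ge> 1" for s
    proof -
      have "- Re s * ln t \<le> \<bar>Re s\<bar> * \<bar>ln t\<bar>" by (metis abs_ge_self abs_minus_cancel abs_mult)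
      also have "\<dots> \<le> max \<bar>A\<bar> \<bar>B\<bar> * \<bar>ln t\<bar>" using s by (intro mult_right_mono) auto
      finally have "norm (complex_of_real t powr (- s)) \<le> exp (max \<bar>A\<bar> \<bar>B\<bar> * \<bar>ln t\<bar>)"
        using t by (simp add: norm_of_real_powr)
      then have "norm (Q s * of_real ((Im s)\<^sup>2)) * norm (complex_of_real t powr (- s)) \<le> C * exp (max \<bar>A\<bar> \<bar>B\<bar> * \<bar>ln t\<bar>)"
        using C(1) C(2)[OF s] by (intro mult_mono) auto
      then show ?thesis by (simp add: f_def norm_mult mult_ac norm_power)
    qed
    then show ?thesis by blast
  qed
  have fint: "integrable lborel (\<lambda>y. f (Complex R y))"
  proof (rule Bochner_Integration.integrable_bound)
    show "integrable lborel (\<lambda>y. complex_of_real (exp (- R * ln t)) * Q (Complex R y))"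
      using int by (rule integrable_mult_right)
    have "(\<lambda>y. complex_of_real t powr (- Complex R y)) \<in> borel_measurable borel"
      unfolding Complex_eq using t by (intro borel_measurable_continuous_onI continuous_intros) auto
    then show "(\<lambda>y. f (Complex R y)) \<in> borel_measurable lborel"
      using int unfolding f_def by measurable
    show "AE y in lborel. norm (f (Complex R y)) \<le> norm (complex_of_real (exp (- R * ln t)) * Q (Complex R y))"
      using t by (simp add: f_def norm_mult norm_of_real_powr)
  qed
  note lim = integral_Icc_tendsto_lborel[OF fint, folded L_def]
  have shift: "has_improper_contour_integral f (\<i> * L) g" if g: "contour g" for g
  proof -
    obtain \<gamma> where vc: "vertical_contour \<gamma> g" using g by (auto simp: contour_def)
    show ?thesis
      by (rule contour_integral_shift_to_line[OF vc closedP hol finP _ fdecay lim PIm])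
         (use g Re_left Re_right in \<open>auto simp: P_def contour_def\<close>)
  qed
  have line: "contour (\<lambda>t. Complex R t)"
    unfolding contour_def using vertical_contour_line Re_left Re_right
    by (blast intro: left_of_line right_of_line)
  have "(THE I. \<exists>g. contour g \<and> has_improper_contour_integral f I g) = \<i> * L"
  proof (rule the_equality)
    show "\<exists>g. contour g \<and> has_improper_contour_integral f (\<i> * L) g" using line shift by blast
    fix I assume "\<exists>g. contour g \<and> has_improper_contour_integral f I g"
    then obtain g where g: "contour g" "has_improper_contour_integral f I g" by blast
    show "I = \<i> * L"
      using g(2) shift[OF g(1)] unfolding has_improper_contour_integral_def
      by (rule tendsto_unique[rotated]) (simp add: prod_filter_eq_bot)
  qed
  then show ?thesis
    unfolding meijer_G_def fox_H_def fox_Xi_real_parameters fox_contour_real_parameters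
    by (simp add: contour_def f_def Q_def L_def field_simps)
qed

section \<open>Assembling the factors on the line\<close>

lemma positive_mixture_Gamma_plus:
  assumes "- a < R"
  shows "positive_mixture (\<lambda>y. Gamma (of_real a + Complex R y))"
  using positive_mixture_Gamma[of "a + R"] assms by (simp add: Complex_eq algebra_simps)

lemma positive_mixture_Gamma_minus:
  assumes "R < r"
  shows "positive_mixture (\<lambda>y. Gamma (of_real r - Complex R y))"
  using positive_mixture_uminus[OF positive_mixture_Gamma[of "r - R"]] assms
  by (simp add: Complex_eq algebra_simps)

lemma positive_mixture_Gamma_ratio_plus:
  assumes "- c < R" "c < d"
  shows "positive_mixture (\<lambda>y. Gamma (of_real c + Complex R y) * rGamma (of_real d + Complex R y))"
  using positive_mixture_Gamma_ratio[of "c + R" "d - c"] assms by (simp add: Complex_eq algebra_simps)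

lemma positive_mixture_Gamma_ratio_minus:
  assumes "R < v" "v < w"
  shows "positive_mixture (\<lambda>y. Gamma (of_real v - Complex R y) * rGamma (of_real w - Complex R y))"
  using positive_mixture_uminus[OF positive_mixture_Gamma_ratio[of "v - R" "w - v"]] assms
  by (simp add: Complex_eq algebra_simps)

text \<open>The head of \<open>gs\<close> is the base: it supplies the positive integrable transform
  and the quadratic decay. Each other factor preserves the first as a mixture and the second as a
  function bounded on strips.\<close>

lemma gamma_product_positive_decaying:
  fixes gs rs :: "real list" and cds vws :: "(real \<times> real) list"
  defines "F \<equiv> \<lambda>s. (\<Prod>a\<leftarrow>gs. Gamma (of_real a + s)) *
      (\<Prod>(c, d)\<leftarrow>cds. Gamma (of_real c + s) * rGamma (of_real d + s)) *
      (\<Prod>r\<leftarrow>rs. Gamma (of_real r - s)) *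
      (\<Prod>(v, w)\<leftarrow>vws. Gamma (of_real v - s) * rGamma (of_real w - s))"
  assumes gs: "gs \<noteq> []" "\<And>a. a \<in> set gs \<Longrightarrow> - a < R"
    and cds: "\<And>c d. (c, d) \<in> set cds \<Longrightarrow> - c < R \<and> c < d"
    and rs: "\<And>r. r \<in> set rs \<Longrightarrow> R < r"
    and vws: "\<And>v w. (v, w) \<in> set vws \<Longrightarrow> R < v \<and> v < w"
  shows "positive_transform (\<lambda>y. F (Complex R y))"
    and "strip_bounded (\<lambda>s. F s * of_real ((Im s)\<^sup>2))"
proof -
  obtain a as where as: "gs = a # as" using gs(1) by (cases gs) auto
  define Fs :: "(complex \<Rightarrow> complex) list" where "Fs = map (\<lambda>a s. Gamma (of_real a + s)) as @
      map (\<lambda>(c, d) s. Gamma (of_real c + s) * rGamma (of_real d + s)) cds @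
      map (\<lambda>r s. Gamma (of_real r - s)) rs @
      map (\<lambda>(v, w) s. Gamma (of_real v - s) * rGamma (of_real w - s)) vws"
  have F: "F s = Gamma (of_real a + s) * (\<Prod>G\<leftarrow>Fs. G s)" for s
    by (simp add: F_def Fs_def as o_def case_prod_unfold mult_ac)
  have factor: "positive_mixture (\<lambda>y. G (Complex R y)) \<and> strip_bounded G" if G: "G \<in> set Fs" for G
  proof -
    have "G \<in> (\<lambda>a s. Gamma (of_real a + s)) ` set as \<union>
      (\<lambda>(c, d) s. Gamma (of_real c + s) * rGamma (of_real d + s)) ` set cds \<union>
      (\<lambda>r s. Gamma (of_real r - s)) ` set rs \<union>
      (\<lambda>(v, w) s. Gamma (of_real v - s) * rGamma (of_real w - s)) ` set vws"
      using G by (simp add: Fs_def Un_assoc)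
    then show ?thesis
    proof (elim UnE imageE)
      fix a assume "G = (\<lambda>s. Gamma (of_real a + s))" "a \<in> set as"
      then show ?thesis using gs(2)[of a]
        by (simp add: as positive_mixture_Gamma_plus strip_bounded_shift[OF strip_bounded_Gamma])
    next
      fix x assume x: "G = (case x of (c, d) \<Rightarrow> \<lambda>s. Gamma (of_real c + s) * rGamma (of_real d + s))" "x \<in> set cds"
      then show ?thesis using cds[of "fst x" "snd x"]
        by (simp add: case_prod_unfold positive_mixture_Gamma_ratio_plus strip_bounded_Gamma_ratio)
    next
      fix r assume "G = (\<lambda>s. Gamma (of_real r - s))" "r \<in> set rs"
      then show ?thesis using rs[of r] strip_bounded_uminus[OF strip_bounded_shift[OF strip_bounded_Gamma, of r]]
        by (simp add: positive_mixture_Gamma_minus)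
    next
      fix x assume x: "G = (case x of (v, w) \<Rightarrow> \<lambda>s. Gamma (of_real v - s) * rGamma (of_real w - s))" "x \<in> set vws"
      then show ?thesis using vws[of "fst x" "snd x"]
          strip_bounded_uminus[OF strip_bounded_Gamma_ratio[of "fst x" "snd x"]]
        by (simp add: case_prod_unfold positive_mixture_Gamma_ratio_minus)
    qed
  qed
  have "positive_transform (\<lambda>y. Gamma (of_real a + Complex R y))"
    using positive_transform_Gamma[of "a + R"] gs(2)[of a] by (simp add: as Complex_eq algebra_simps)
  from positive_mixture_mult_list[OF this, of "map (\<lambda>G y. G (Complex R y)) Fs"] factor
  show "positive_transform (\<lambda>y. F (Complex R y))"
    by (auto simp: F o_def)
  have "strip_bounded (\<lambda>s. Gamma s * of_real ((Im s)\<^sup>2))"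
    unfolding strip_bounded_def using Gamma_vertical_decay by (simp add: norm_mult norm_power)
  from strip_bounded_mult[OF strip_bounded_shift[OF this, of a] strip_bounded_prod_list[of Fs]] factor
  show "strip_bounded (\<lambda>s. F s * of_real ((Im s)\<^sup>2))"
    by (simp add: F mult_ac)
qed

lemma prod_list_mult: "(\<Prod>x\<leftarrow>xs. f x * g x) = (\<Prod>x\<leftarrow>xs. f x) * (\<Prod>x\<leftarrow>xs. g x :: 'a :: comm_monoid_mult)"
  by (induction xs) (simp_all add: mult_ac)

text \<open>On the line the value is \<open>t powr (- R) / (2 * pi)\<close> times the inverse
  transform at \<open>ln t\<close>.\<close>

theorem meijer_G_positive:
  fixes bs rs os :: "real list" and cds vws :: "(real \<times> real) list"
  assumes t: "t > 0" and ne: "bs @ os \<noteq> []"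
    and bs: "\<And>a. a \<in> set (bs @ os) \<Longrightarrow> - a < R"
    and cds: "\<And>c d. (c, d) \<in> set cds \<Longrightarrow> - c < R \<and> c < d"
    and rs: "\<And>r. r \<in> set rs \<Longrightarrow> R < r"
    and vws: "\<And>v w. (v, w) \<in> set vws \<Longrightarrow> R < v \<and> v < w"
  shows "\<exists>x>0. meijer_G (length bs + length cds + length os) (length rs + length vws)
      (map (\<lambda>r. complex_of_real (1 - r)) rs @ map (\<lambda>(v, w). complex_of_real (1 - v)) vws @
       map (\<lambda>(c, d). complex_of_real d) cds)
      (map complex_of_real bs @ map (\<lambda>(c, d). complex_of_real c) cds @ map complex_of_real os @
       map (\<lambda>(v, w). complex_of_real (1 - w)) vws) t = complex_of_real x"
proof -
  let ?\<beta>s = "bs @ map fst cds @ os" and ?\<rho>s = "rs @ map fst vws"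
  define Q where "Q = gamma_quotient ?\<beta>s ?\<rho>s (map snd vws) (map snd cds)"
  \<comment> \<open>Each numerator \<open>c\<close>, \<open>v\<close> is paired with its denominator
    \<open>d\<close>, \<open>w\<close>, while \<open>os\<close> joins \<open>bs\<close>, since both
    give unpaired factors \<open>Gamma (a + s)\<close>.\<close>
  have Q: "Q = (\<lambda>s. (\<Prod>a\<leftarrow>bs @ os. Gamma (of_real a + s)) *
      (\<Prod>(c, d)\<leftarrow>cds. Gamma (of_real c + s) * rGamma (of_real d + s)) *
      (\<Prod>r\<leftarrow>rs. Gamma (of_real r - s)) *
      (\<Prod>(v, w)\<leftarrow>vws. Gamma (of_real v - s) * rGamma (of_real w - s)))"
    by (rule ext) (simp add: Q_def gamma_quotient_def prod_list_mult case_prod_unfold o_def mult_ac)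
  have pos: "positive_transform (\<lambda>y. Q (Complex R y))" "strip_bounded (\<lambda>s. Q s * of_real ((Im s)\<^sup>2))"
    unfolding Q by (rule gamma_product_positive_decaying[OF ne]; use bs cds rs vws in blast)+
  have int: "integrable lborel (\<lambda>y. Q (Complex R y))"
    using pos(1) by (simp add: positive_transform_def)
  obtain p where p: "p > 0" "(LINT y|lborel. Q (Complex R y) * cis (- (ln t * y))) = complex_of_real p"
    using pos(1) by (auto simp: positive_transform_def)
  have powr: "complex_of_real t powr (- Complex R y) = complex_of_real (t powr (- R)) * cis (- (ln t * y))" for y
  proof -
    have "- Complex R y = Complex (1 - R) (- y) - 1" by (simp add: complex_eq_iff)
    then show ?thesis using of_real_powr_Complex[OF t, of "1 - R" "- y"] by (simp add: mult.commute)
  qed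
  have "meijer_G (length ?\<beta>s) (length ?\<rho>s)
      (map (\<lambda>\<rho>. complex_of_real (1 - \<rho>)) ?\<rho>s @ map complex_of_real (map snd cds))
      (map complex_of_real ?\<beta>s @ map (\<lambda>w. complex_of_real (1 - w)) (map snd vws)) t =
    (LINT y|lborel. Q (Complex R y) * complex_of_real t powr (- Complex R y)) / (2 * of_real pi)"
    unfolding Q_def
    by (rule meijer_G_line_integral[OF t]) (use int pos(2) bs cds rs vws in \<open>auto simp: Q_def\<close>)
  also have "(LINT y|lborel. Q (Complex R y) * complex_of_real t powr (- Complex R y)) =
      (LINT y|lborel. complex_of_real (t powr (- R)) * (Q (Complex R y) * cis (- (ln t * y))))"
    by (simp only: powr mult.left_commute)
  also have "\<dots> = complex_of_real (t powr (- R) * p)"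
    by (subst integral_mult_right_zero) (simp add: p(2))
  also have "complex_of_real (t powr (- R) * p) / (2 * of_real pi) = complex_of_real (t powr (- R) * p / (2 * pi))"
    by simp
  finally show ?thesis
    using p(1) t by (intro exI[of _ "t powr (- R) * p / (2 * pi)"]) (simp add: case_prod_unfold o_def add.assoc)
qed

theorem corollary6p5:
  fixes n1 n2 n3 n4 m' n' p' q' :: nat
    and lam :: real
    and b c d r ob v w :: "nat \<Rightarrow> real"
    and \<alpha>' \<beta>' A' B' :: "real list"
  assumes "n1 \<ge> 1 \<or> n3 \<ge> 1"
    and "lam > 0"
    and "\<forall>j\<in>{1..n1}. b j \<ge> 0"
    and "\<forall>j\<in>{1..n2}. c j \<ge> 0 \<and> d j \<ge> c j + 1"
    and "\<forall>j\<in>{1..n3}. r j > 0 \<and> ob j \<ge> 0"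
    and "\<forall>j\<in>{1..n4}. v j > 0 \<and> w j \<ge> v j + 1"
    and "m' = n1 + n2 + n3"
    and "n' = n3 + n4"
    and "p' = n2 + n3 + n4"
    and "q' = n1 + n2 + n3 + n4"
    and "\<alpha>' = map (\<lambda>j. 1 - r j) [1..<n3 + 1] @ map (\<lambda>j. 1 - v j) [1..<n4 + 1]
               @ map d [1..<n2 + 1]"
    and "\<beta>' = map b [1..<n1 + 1] @ map c [1..<n2 + 1] @ map ob [1..<n3 + 1]
               @ map (\<lambda>j. 1 - w j) [1..<n4 + 1]"
    and "A' = replicate p' lam"
    and "B' = replicate q' lam"
    and "\<forall>j<n'. \<forall>j'<m'. \<forall>l l' :: nat.
           A' ! j * (\<beta>' ! j' + real l) \<noteq> B' ! j' * (\<alpha>' ! j - real l' - 1)"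
  shows "\<forall>\<omega>>0. \<forall>t>0. \<forall>\<sigma>\<in>{1, -1 :: real}.
           (let G = meijer_G m' n' (map (\<lambda>\<alpha>. complex_of_real (\<alpha> + \<sigma> * \<omega>)) \<alpha>')
                                   (map (\<lambda>\<beta>. complex_of_real (\<beta> + \<sigma> * \<omega>)) \<beta>') t
            in G \<in> \<real> \<and> Re G > 0)"
proof (intro allI impI ballI)
  fix \<omega> t \<sigma> :: real
  assume t: "t > 0"
  define \<delta> where "\<delta> = \<sigma> * \<omega>"
  \<comment> \<open>The inserted 1 keeps the set nonempty when there are no \<open>r\<close> and no
    \<open>v\<close>.\<close>
  define S where "S = insert 1 (r ` {1..n3} \<union> v ` {1..n4})"
  \<comment> \<open>Half the minimum leaves room on both sides: above 0, where the left poles may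
    reach in the shifted variable, and below every \<open>r\<close> and \<open>v\<close>.\<close>
  define R where "R = Min S / 2"
  have S: "finite S" "S \<noteq> {}" by (auto simp: S_def)
  have "Min S > 0" using S assms(5,6) by (subst Min_gr_iff) (auto simp: S_def)
  then have R: "R > 0" "\<And>x. x \<in> S \<Longrightarrow> R < x"
    using Min_le[OF S(1)] by (auto simp: R_def) (smt (verit) field_sum_of_halves)
  have upt: "set [1..<k + 1] = {1..k}" for k by auto
  let ?bs = "map (\<lambda>j. b j + \<delta>) [1..<n1 + 1]" and ?os = "map (\<lambda>j. ob j + \<delta>) [1..<n3 + 1]"
  let ?cds = "map (\<lambda>j. (c j + \<delta>, d j + \<delta>)) [1..<n2 + 1]"
  let ?rs = "map (\<lambda>j. r j - \<delta>) [1..<n3 + 1]"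
  let ?vws = "map (\<lambda>j. (v j - \<delta>, w j - \<delta>)) [1..<n4 + 1]"
  have "\<exists>x>0. meijer_G (length ?bs + length ?cds + length ?os) (length ?rs + length ?vws)
      (map (\<lambda>r. complex_of_real (1 - r)) ?rs @ map (\<lambda>(v, w). complex_of_real (1 - v)) ?vws @
       map (\<lambda>(c, d). complex_of_real d) ?cds)
      (map complex_of_real ?bs @ map (\<lambda>(c, d). complex_of_real c) ?cds @ map complex_of_real ?os @
       map (\<lambda>(v, w). complex_of_real (1 - w)) ?vws) t = complex_of_real x"
  \<comment> \<open>The shift adds \<open>\<delta>\<close> to all parameters of both lists, which
    translates every pole by \<open>- \<delta>\<close>; the separating line moves along.\<close>
  proof (rule meijer_G_positive[OF t, where R = "R - \<delta>"])
    show "?bs @ ?os \<noteq> []" using assms(1) by auto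
    show "- a < R - \<delta>" if elem: "a \<in> set (?bs @ ?os)" for a
    proof -
      consider j where "j \<in> {1..n1}" "a = b j + \<delta>" | j where "j \<in> {1..n3}" "a = ob j + \<delta>"
        using elem unfolding set_append set_map upt by blast
      then show ?thesis using assms(3,5) R(1) by cases fastforce+
    qed
    show "- x < R - \<delta> \<and> x < y" if elem: "(x, y) \<in> set ?cds" for x y
    proof -
      obtain j where "j \<in> {1..n2}" "x = c j + \<delta>" "y = d j + \<delta>"
        using elem unfolding set_map upt by blast
      then show ?thesis using assms(4) R(1) by fastforce
    qed
    show "R - \<delta> < x" if elem: "x \<in> set ?rs" for x
    proof -
      obtain j where "j \<in> {1..n3}" "x = r j - \<delta>"
        using elem unfolding set_map upt by blast
      then show ?thesis using R(2)[of "r j"] by (simp add: S_def)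
    qed
    show "R - \<delta> < x \<and> x < y" if elem: "(x, y) \<in> set ?vws" for x y
    proof -
      obtain j where "j \<in> {1..n4}" "x = v j - \<delta>" "y = w j - \<delta>"
        using elem unfolding set_map upt by blast
      then show ?thesis using R(2)[of "v j"] assms(6) by (fastforce simp: S_def)
    qed
  qed
  \<comment> \<open>The lists carry 1 minus the parameter for \<open>r\<close>, \<open>v\<close>,
    \<open>w\<close>, so adding \<open>\<delta>\<close> to the parameter means subtracting it
    there.\<close>
  moreover have "1 - (x - \<delta>) = 1 - x + \<delta>" for x by simp
  ultimately have "\<exists>x>0. meijer_G m' n' (map (\<lambda>\<alpha>. complex_of_real (\<alpha> + \<sigma> * \<omega>)) \<alpha>')
      (map (\<lambda>\<beta>. complex_of_real (\<beta> + \<sigma> * \<omega>)) \<beta>') t = complex_of_real x"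
    unfolding assms(7,8,11,12) \<delta>_def[symmetric] by (simp add: o_def del: upt_Suc of_real_add of_real_diff)
  then show "let G = meijer_G m' n' (map (\<lambda>\<alpha>. complex_of_real (\<alpha> + \<sigma> * \<omega>)) \<alpha>')
      (map (\<lambda>\<beta>. complex_of_real (\<beta> + \<sigma> * \<omega>)) \<beta>') t in G \<in> \<real> \<and> Re G > 0"
    by (auto simp: Let_def)
qed

end
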